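(* Suppose $\kappa$ is inaccessible, $\dagger(\kappa, f, g)$ holds, $\mathfrak{U} = (\chi, \mathcal{S})$ is a universal algebra with $2 \leq |\chi| < \kappa$, and $\mathrm{Av}$ is an average for $\mathfrak{U}$. Then there is a homomorphic projection $\mathcal{E}_1: \mathfrak{U}^{\kappa}/\sim \to \mathfrak{U}^{\kappa}/\sim$ (i.e. a homomorphism with $\mathcal{E}_1\circ\mathcal{E}_1=\mathcal{E}_1$), whose image is isomorphic to $\mathfrak{U}^{\kappa}/\sim$, such that every homomorphism $\Delta: \mathfrak{U}^{\kappa} \to \mathfrak{U}^{\kappa}$ with $p_{\sim}\circ\Delta = \mathcal{E}_1\circ p_{\sim}$ satisfies, for every cardinal $\lambda<\kappa$, $$|\{\alpha \in \kappa: \pi_{\alpha} \circ \Delta\text{ has no strong support of cardinality} \leq \lambda\}| = \kappa.$$ Moreover, if $\mathrm{Av}$ is changing, then there exists $\sigma \in \mathfrak{U}^{\kappa}$ such that whenever $\mathcal{E}_1[\sigma]_{\sim} = [\tau]_{\sim}$ we have $|\{\alpha \in \kappa: \sigma(\alpha) = \tau(\alpha)\}| < \kappa$.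
   Context: For $f,g \in {}^{\kappa}\mathrm{Card}$, $\mathfrak{d}_{f,g}$ is the least cardinality of a family $\mathcal{D} \subseteq \prod_{\nu\in\kappa}[f(\nu)]^{g(\nu)}$ such that for every $F \in \prod_{\nu\in\kappa} f(\nu)$ there are $G \in \mathcal{D}$ and $\beta\in\kappa$ with $F(\nu) \in G(\nu)$ for all $\nu \in \kappa\setminus\beta$. $\dagger(\kappa,f,g)$ means: $f,g: \kappa \to \kappa \cap \mathrm{Card}$, all $f(\nu),g(\nu)$ infinite regular cardinals, and (1) $2^{g(\nu)} < f(\nu)$; (2) if $\nu < \nu^*$ then $|\nu| \le g(\nu) \le g(\nu^* )$; (3) $\mathfrak{d}_{2^{f},g} = \kappa^+$ where $2^f(\nu)=2^{f(\nu)}$. An average for $\mathfrak{U}$ is a homomorphism $\mathrm{Av}: \mathfrak{U}\times\mathfrak{U}\to\mathfrak{U}$ with $\mathrm{Av}(x_0,x_1)=\mathrm{Av}(x_1,x_0)$ and $\mathrm{Av}(x_0,x_0)=x_0$ for all $x_0,x_1\in\chi$; it is changing if there exist $x_0,x_1$ with $x_0 \ne \mathrm{Av}(x_0,x_1) \ne x_1$. $\sigma\sim\tau$ in $\mathfrak{U}^{\kappa}$ means $|\{\alpha:\sigma(\alpha)\ne\tau(\alpha)\}|<\kappa$; $p_\sim$ is the quotient homomorphism; $\pi_\alpha$ the $\alpha$-th coordinate projection. For a homomorphism $\Theta: \mathfrak{U}^{Z} \to \mathfrak{M}$, $Y \subseteq Z$ is a strong support if (i) $\sigma \upharpoonright Y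 = \tau \upharpoonright Y$ implies $\Theta\sigma = \Theta\tau$, and (ii) for each $y \in Y$ and $\sigma$ there is $x \in \chi$ such that changing the $y$-th coordinate of $\sigma$ to $x$ changes the value of $\Theta$. *)

theory Defs
  imports Main "HOL-Library.FuncSet"
begin

unbundle cardinal_syntax

section \<open>Cardinals\<close>

text \<open>
  A cardinal is a well-order relation \<open>k\<close> with \<open>Card_order k\<close>. The ordinals below \<open>k\<close> are the
  elements of \<open>Field k\<close>, and such an ordinal \<open>\<nu>\<close>, as the set of its predecessors, is \<open>underS k \<nu>\<close>.
  Every cardinal below \<open>k\<close> has a copy on the type of the elements of \<open>Field k\<close>, so ranging over
  relations on that type loses no generality.
\<close>

definition inaccessible :: "'k rel \<Rightarrow> bool" where
  "inaccessible k \<longleftrightarrow>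
     Card_order k \<and> natLeq <o k \<and> regularCard k \<and>
     (\<forall>r :: 'k rel. Card_order r \<and> r <o k \<longrightarrow> ctwo ^c r <o k)"

definition subsets_of_card :: "'a set \<Rightarrow> 'b rel \<Rightarrow> 'a set set" where
  "subsets_of_card A r = {X. X \<subseteq> A \<and> |X| =o r}"

definition eventually_covering ::
  "'k rel \<Rightarrow> ('k \<Rightarrow> 'a rel) \<Rightarrow> ('k \<Rightarrow> 'b rel) \<Rightarrow> ('k \<Rightarrow> 'a set) set \<Rightarrow> bool" where
  "eventually_covering k f g D \<longleftrightarrow>
     D \<subseteq> (\<Pi>\<^sub>E \<nu>\<in>Field k. subsets_of_card (Field (f \<nu>)) (g \<nu>)) \<and>
     (\<forall>F \<in> (\<Pi>\<^sub>E \<nu>\<in>Field k. Field (f \<nu>)).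
        \<exists>G\<in>D. \<exists>\<beta>\<in>Field k. \<forall>\<nu> \<in> Field k - underS k \<beta>. F \<nu> \<in> G \<nu>)"

text \<open>
  \<open>dnum k f g\<close> is the least cardinality of a covering family. As with all cardinals in this
  representation, it is meaningful up to \<open>=o\<close>.
\<close>

definition dnum ::
  "'k rel \<Rightarrow> ('k \<Rightarrow> 'a rel) \<Rightarrow> ('k \<Rightarrow> 'b rel) \<Rightarrow> ('k \<Rightarrow> 'a set) rel" where
  "dnum k f g =
     |SOME D. eventually_covering k f g D \<and>
              (\<forall>D'. eventually_covering k f g D' \<longrightarrow> |D| \<le>o |D'| )|"

definition dagger :: "'k rel \<Rightarrow> ('k \<Rightarrow> 'k rel) \<Rightarrow> ('k \<Rightarrow> 'k rel) \<Rightarrow> bool" where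
  "dagger k f g \<longleftrightarrow>
     (\<forall>\<nu>\<in>Field k. Cinfinite (f \<nu>) \<and> regularCard (f \<nu>) \<and> f \<nu> <o k) \<and>
     (\<forall>\<nu>\<in>Field k. Cinfinite (g \<nu>) \<and> regularCard (g \<nu>) \<and> g \<nu> <o k) \<and>
     (\<forall>\<nu>\<in>Field k. ctwo ^c g \<nu> <o f \<nu>) \<and>
     (\<forall>\<nu>' \<in> Field k. \<forall>\<nu> \<in> underS k \<nu>'. |underS k \<nu>| \<le>o g \<nu> \<and> g \<nu> \<le>o g \<nu>') \<and>
     dnum k (\<lambda>\<nu>. ctwo ^c f \<nu>) g =o cardSuc k"

section \<open>Universal algebras\<close>

text \<open>
  The operations are finitary and form a family indexed by a set of operation symbols, so that
  algebras derived from one another (powers, quotients) have corresponding operations.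
\<close>

record ('a, 's) ualg =
  universe :: "'a set"
  symbols :: "'s set"
  arity :: "'s \<Rightarrow> nat"
  interp :: "'s \<Rightarrow> 'a list \<Rightarrow> 'a"

definition args :: "('a, 's) ualg \<Rightarrow> 's \<Rightarrow> 'a list set" where
  "args A s = {xs. length xs = arity A s \<and> set xs \<subseteq> universe A}"

definition universal_algebra :: "('a, 's) ualg \<Rightarrow> bool" where
  "universal_algebra A \<longleftrightarrow> (\<forall>s\<in>symbols A. \<forall>xs\<in>args A s. interp A s xs \<in> universe A)"

definition ualg_hom :: "('a, 's) ualg \<Rightarrow> ('b, 's) ualg \<Rightarrow> ('a \<Rightarrow> 'b) set" where
  "ualg_hom A B = {h \<in> universe A \<rightarrow> universe B.
     symbols A = symbols B \<and>
     (\<forall>s\<in>symbols A. arity A s = arity B s \<and>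
        (\<forall>xs\<in>args A s. h (interp A s xs) = interp B s (map h xs)))}"

definition ualg_isomorphic :: "('a, 's) ualg \<Rightarrow> ('b, 's) ualg \<Rightarrow> bool" where
  "ualg_isomorphic A B \<longleftrightarrow> (\<exists>h \<in> ualg_hom A B. bij_betw h (universe A) (universe B))"

definition hom_image :: "('a \<Rightarrow> 'b) \<Rightarrow> ('a, 's) ualg \<Rightarrow> ('b, 's) ualg \<Rightarrow> ('b, 's) ualg" where
  "hom_image h A B = B\<lparr>universe := h ` universe A\<rparr>"

definition ualg_prod :: "('a, 's) ualg \<Rightarrow> ('b, 's) ualg \<Rightarrow> ('a \<times> 'b, 's) ualg" where
  "ualg_prod A B =
     \<lparr>universe = universe A \<times> universe B, symbols = symbols A, arity = arity A,
      interp = (\<lambda>s ps. (interp A s (map fst ps), interp B s (map snd ps)))\<rparr>"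

definition ualg_power :: "('a, 's) ualg \<Rightarrow> 'i set \<Rightarrow> ('i \<Rightarrow> 'a, 's) ualg" where
  "ualg_power A Z =
     \<lparr>universe = (\<Pi>\<^sub>E z\<in>Z. universe A), symbols = symbols A, arity = arity A,
      interp = (\<lambda>s \<sigma>s. \<lambda>z\<in>Z. interp A s (map (\<lambda>\<sigma>. \<sigma> z) \<sigma>s))\<rparr>"

text \<open>
  For a congruence \<open>R\<close>, the operation applied to a list of classes is the class of its value
  at any list of representatives.
\<close>

definition ualg_quotient :: "('a, 's) ualg \<Rightarrow> 'a rel \<Rightarrow> ('a set, 's) ualg" where
  "ualg_quotient A R =
     \<lparr>universe = universe A // R, symbols = symbols A, arity = arity A,
      interp = (\<lambda>s Xs. R `` {interp A s xs | xs. list_all2 (\<in>) xs Xs})\<rparr>"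

definition average :: "('a, 's) ualg \<Rightarrow> ('a \<times> 'a \<Rightarrow> 'a) \<Rightarrow> bool" where
  "average A Av \<longleftrightarrow>
     Av \<in> ualg_hom (ualg_prod A A) A \<and>
     (\<forall>x\<^sub>0\<in>universe A. \<forall>x\<^sub>1\<in>universe A. Av (x\<^sub>0, x\<^sub>1) = Av (x\<^sub>1, x\<^sub>0)) \<and>
     (\<forall>x\<^sub>0\<in>universe A. Av (x\<^sub>0, x\<^sub>0) = x\<^sub>0)"

definition changing :: "('a, 's) ualg \<Rightarrow> ('a \<times> 'a \<Rightarrow> 'a) \<Rightarrow> bool" where
  "changing A Av \<longleftrightarrow>
     (\<exists>x\<^sub>0\<in>universe A. \<exists>x\<^sub>1\<in>universe A. x\<^sub>0 \<noteq> Av (x\<^sub>0, x\<^sub>1) \<and> Av (x\<^sub>0, x\<^sub>1) \<noteq> x\<^sub>1)"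

definition strong_support ::
  "('a, 's) ualg \<Rightarrow> 'i set \<Rightarrow> (('i \<Rightarrow> 'a) \<Rightarrow> 'b) \<Rightarrow> 'i set \<Rightarrow> bool" where
  "strong_support A Z \<Theta> Y \<longleftrightarrow>
     Y \<subseteq> Z \<and>
     (\<forall>\<sigma> \<in> universe (ualg_power A Z). \<forall>\<tau> \<in> universe (ualg_power A Z).
        restrict \<sigma> Y = restrict \<tau> Y \<longrightarrow> \<Theta> \<sigma> = \<Theta> \<tau>) \<and>
     (\<forall>y\<in>Y. \<forall>\<sigma> \<in> universe (ualg_power A Z). \<exists>x\<in>universe A. \<Theta> (\<sigma>(y := x)) \<noteq> \<Theta> \<sigma>)"

definition small_diff :: "('a, 's) ualg \<Rightarrow> 'k rel \<Rightarrow> ('k \<Rightarrow> 'a) rel" where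
  "small_diff A k =
     {(\<sigma>, \<tau>). \<sigma> \<in> universe (ualg_power A (Field k)) \<and> \<tau> \<in> universe (ualg_power A (Field k)) \<and>
              |{\<alpha> \<in> Field k. \<sigma> \<alpha> \<noteq> \<tau> \<alpha>}| <o k}"

definition reduced_power :: "('a, 's) ualg \<Rightarrow> 'k rel \<Rightarrow> (('k \<Rightarrow> 'a) set, 's) ualg" where
  "reduced_power A k = ualg_quotient (ualg_power A (Field k)) (small_diff A k)"

definition quot_map :: "('a, 's) ualg \<Rightarrow> 'k rel \<Rightarrow> ('k \<Rightarrow> 'a) \<Rightarrow> ('k \<Rightarrow> 'a) set" where
  "quot_map A k \<sigma> = small_diff A k `` {\<sigma>}"

end

theory Submission
  imports Defs "HOL.Filter"
begin

text \<open>
  The projection averages the two coordinates of each pair of a perfect matching of \<open>\<kappa>\<close>, given by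
  an involution \<open>q \<xi>\<close>; the matching varies with a stage \<open>\<xi>\<close> below \<open>\<kappa>\<^sup>+\<close>. A covering
  family of \<open>\<kappa>\<^sup>+\<close> slaloms captures every \<open>\<sigma>\<close> at some stage, and later stages only modify
  the matching by transpositions that are invisible to everything captured so far. Hence the class of the
  averaged sequence stabilises along the stages and defines a homomorphism on the reduced power.
  Since \<open>2\<close> to the power \<open>g \<nu>\<close> is below \<open>f \<nu>\<close>, the pigeonhole principle always provides two points of the
  \<open>\<nu>\<close>-th block that no captured sequence distinguishes; because the transpositions have disjoint supports,
  limit stages are simply unions. The slaloms also capture every assignment of small supports,
  and the transposition added at that stage is chosen to leave these supports, which makes it
  impossible for a lift to have them.
\<close>

section \<open>Cardinals and the co-small filter\<close>

text \<open>Averaging over one fixed matching cannot suffice: that map lifts to the power with every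
  coordinate depending only on itself and its partner. So the matching has to keep moving, while
  each single sequence must eventually stop noticing the movement. The cardinal hypotheses balance
  these demands block by block. A block has f(\<nu>) points, so a sequence or a relation on it is
  one of at most 2^f(\<nu>) objects; this is why the covering number is taken for 2^f. A stage has
  at most \<kappa> predecessors, and block \<nu> attends to at most |\<nu>| \<le> g(\<nu>) of them,
  each with at most g(\<nu>) captured sequences; this stays within reach of the pigeonhole
  principle. Finally \<kappa> is split into two halves and every transposition is combined with an
  exchange of the halves. All matchings thereby become perfect and share one transversal, on which
  the isomorphism with the image and the changing case rest.\<close>

lemma card_of_UN_le:
  assumes "Cinfinite r" "|I| \<le>o r" "\<And>i. i \<in> I \<Longrightarrow> |A i| \<le>o r"
  shows "|\<Union>i\<in>I. A i| \<le>o r"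
  using assms card_of_UNION_ordLeq_infinite_Field[of r I A] unfolding cinfinite_def by blast

lemma card_of_Un_le:
  assumes "Cinfinite r" "|A| \<le>o r" "|B| \<le>o r"
  shows "|A \<union> B| \<le>o r"
  using assms card_of_Un_ordLeq_infinite_Field[of r A B] unfolding cinfinite_def by blast

lemma card_of_Times_le:
  assumes "Cinfinite r" "|A| \<le>o r" "|B| \<le>o r"
  shows "|A \<times> B| \<le>o r"
  using assms card_of_Times_ordLeq_infinite_Field[of r A B] unfolding cinfinite_def by blast

lemma finite_card_of_less: "Cinfinite r \<Longrightarrow> finite A \<Longrightarrow> |A| <o r"
  by (intro Cfinite_ordLess_Cinfinite) (auto simp: cfinite_def card_of_card_order_on Field_card_of)

lemma finite_card_of_le: "Cinfinite r \<Longrightarrow> finite A \<Longrightarrow> |A| \<le>o r"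
  using finite_card_of_less ordLess_imp_ordLeq by blast

lemma card_of_image_le: "|A| \<le>o r \<Longrightarrow> |h ` A| \<le>o r"
  using card_of_image ordLeq_transitive by blast

lemma card_of_subset_le: "A \<subseteq> B \<Longrightarrow> |B| \<le>o r \<Longrightarrow> |A| \<le>o r"
  using card_of_mono1 ordLeq_transitive by blast

lemma card_of_subset_less: "A \<subseteq> B \<Longrightarrow> |B| <o r \<Longrightarrow> |A| <o r"
  using card_of_mono1 ordLeq_ordLess_trans by blast

lemma card_of_Pow_le_ctwo_cexp:
  assumes "|A| \<le>o r" "Cinfinite r"
  shows "|Pow A| \<le>o ctwo ^c r"
proof (cases "A = {}")
  case True
  have "Cinfinite (ctwo ^c r)"
    by (rule Cinfinite_cexp) (use assms(2) in \<open>auto intro: ordLeq_refl Card_order_ctwo\<close>)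
  then show ?thesis using True finite_card_of_le[of "ctwo ^c r" "Pow A"] by blast
next
  case False
  have "|Pow A| =o ctwo ^c |A|"
    unfolding cexp_def ctwo_def Field_card_of by (rule card_of_Pow_Func)
  also have "ctwo ^c |A| \<le>o ctwo ^c r"
    by (rule cexp_mono2') (use assms False in \<open>auto simp: Card_order_ctwo Field_card_of\<close>)
  finally show ?thesis .
qed

section \<open>Small subsets of a regular cardinal\<close>

locale regular_cardinal =
  fixes \<kappa> :: "'k rel"
  assumes Cinfinite: "Cinfinite \<kappa>" and regular: "regularCard \<kappa>"
begin

lemma Card_order: "Card_order \<kappa>"
  using Cinfinite by blast

lemma wo: "wo_rel \<kappa>"
  using Card_order unfolding card_order_on_def wo_rel_def by blast

lemma card_Field: "|Field \<kappa>| =o \<kappa>"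
  using Card_order card_of_Field_ordIso by blast

lemma not_less: "\<not> |A| <o \<kappa> \<longleftrightarrow> \<kappa> \<le>o |A|"
  using Card_order card_of_Well_order card_order_on_well_order_on not_ordLess_iff_ordLeq by blast

lemma card_of_subset_Field: "A \<subseteq> Field \<kappa> \<Longrightarrow> \<not> |A| <o \<kappa> \<Longrightarrow> |A| =o \<kappa>"
  using ordLeq_ordIso_trans[OF card_of_mono1 card_Field, of A] by (simp add: not_less ordIso_iff_ordLeq)

lemma small_UN: "|I| <o \<kappa> \<Longrightarrow> (\<And>i. i \<in> I \<Longrightarrow> |A i| <o \<kappa>) \<Longrightarrow> |\<Union>i\<in>I. A i| <o \<kappa>"
  by (rule card_of_UNION_ordLess_infinite_Field_regularCard[OF regular Cinfinite]) simp_all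

lemma small_finite: "finite A \<Longrightarrow> |A| <o \<kappa>"
  using Cinfinite finite_card_of_less by blast

lemma small_Un: "|A| <o \<kappa> \<Longrightarrow> |B| <o \<kappa> \<Longrightarrow> |A \<union> B| <o \<kappa>"
  using small_UN[of "UNIV :: bool set" "\<lambda>b. if b then A else B"] small_finite[of "UNIV :: bool set"]
  by (auto simp: UNIV_bool Un_commute)

lemma small_image: "|A| <o \<kappa> \<Longrightarrow> |h ` A| <o \<kappa>"
  using card_of_image ordLeq_ordLess_trans by blast

lemma small_inj_vimage:
  assumes "|A| <o \<kappa>" "inj_on h B" "h ` B \<subseteq> A"
  shows "|B| <o \<kappa>"
  using ordLeq_ordLess_trans[OF card_of_ordLeqI[of h B A] assms(1)] assms(2,3) by (simp add: image_subset_iff)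

lemma small_underS: "|underS \<kappa> \<nu>| <o \<kappa>"
proof (cases "\<nu> \<in> Field \<kappa>")
  case True
  then show ?thesis by (rule card_of_underS[OF Card_order])
next
  case False
  then have "underS \<kappa> \<nu> = {}" by (auto simp: underS_def intro: FieldI2)
  then show ?thesis by (simp add: small_finite)
qed

lemma small_Field_Diff_Ex: "|A| <o \<kappa> \<Longrightarrow> \<exists>\<nu>\<in>Field \<kappa>. \<nu> \<notin> A"
  using card_of_subset_less[of "Field \<kappa>" A \<kappa>] card_Field not_ordLess_ordIso by blast

text \<open>Dual filter of the ideal of sets of size below \<kappa>; eventual equality along it is
  the congruence of the reduced power. Points of the type outside \<open>Field \<kappa>\<close> are
  ignored, so membership in the field is recovered through \<open>eventually_Field\<close>.\<close>

definition co_small :: "'k filter" where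
  "co_small = Abs_filter (\<lambda>P. |{\<nu> \<in> Field \<kappa>. \<not> P \<nu>}| <o \<kappa>)"

lemma eventually_co_small: "eventually P co_small \<longleftrightarrow> |{\<nu> \<in> Field \<kappa>. \<not> P \<nu>}| <o \<kappa>"
  unfolding co_small_def
proof (rule eventually_Abs_filter, rule is_filter.intro)
  show "|{\<nu> \<in> Field \<kappa>. \<not> True}| <o \<kappa>" by (simp add: small_finite)
  fix P Q :: "'k \<Rightarrow> bool"
  show "|{\<nu> \<in> Field \<kappa>. \<not> Q \<nu>}| <o \<kappa>" if "\<forall>\<nu>. P \<nu> \<longrightarrow> Q \<nu>" "|{\<nu> \<in> Field \<kappa>. \<not> P \<nu>}| <o \<kappa>"
    by (rule card_of_subset_less[OF _ that(2)]) (use that(1) in blast)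
  show "|{\<nu> \<in> Field \<kappa>. \<not> (P \<nu> \<and> Q \<nu>)}| <o \<kappa>"
    if "|{\<nu> \<in> Field \<kappa>. \<not> P \<nu>}| <o \<kappa>" "|{\<nu> \<in> Field \<kappa>. \<not> Q \<nu>}| <o \<kappa>"
    by (rule card_of_subset_less[OF _ small_Un[OF that]]) blast
qed

lemma eventually_Field: "eventually (\<lambda>\<nu>. \<nu> \<in> Field \<kappa>) co_small"
  by (simp add: eventually_co_small small_finite)

text \<open>Regularity makes the filter \<kappa>-complete: fewer than \<kappa> small exceptional
  sets have a small union.\<close>

lemma eventually_small_ball:
  assumes "|I| <o \<kappa>" "\<And>i. i \<in> I \<Longrightarrow> eventually (P i) co_small"
  shows "eventually (\<lambda>\<nu>. \<forall>i\<in>I. P i \<nu>) co_small"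
  unfolding eventually_co_small
  by (rule card_of_subset_less[OF _ small_UN[OF assms(1), of "\<lambda>i. {\<nu> \<in> Field \<kappa>. \<not> P i \<nu>}"]])
    (use assms(2) in \<open>auto simp: eventually_co_small\<close>)

lemma eventually_not_small: "|A| <o \<kappa> \<Longrightarrow> eventually (\<lambda>\<nu>. \<nu> \<notin> A) co_small"
  unfolding eventually_co_small by (erule card_of_subset_less[rotated]) auto

lemma eventually_above:
  assumes "\<nu> \<in> Field \<kappa>"
  shows "eventually (\<lambda>\<nu>'. \<nu> \<in> underS \<kappa> \<nu>') co_small"
proof -
  have "|insert \<nu> (underS \<kappa> \<nu>)| <o \<kappa>"
    using small_Un[of "{\<nu>}" "underS \<kappa> \<nu>"] small_finite[of "{\<nu>}"] small_underS by simp
  from eventually_not_small[OF this] eventually_Field show ?thesis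
  proof eventually_elim
    case (elim \<nu>')
    then have "(\<nu>, \<nu>') \<in> \<kappa> \<or> (\<nu>', \<nu>) \<in> \<kappa>"
      using assms wo_rel.TOTALS[OF wo] by blast
    then show ?case using elim(1) unfolding underS_def by blast
  qed
qed

lemma eventually_ge: "eventually (\<lambda>\<nu>'. \<nu>' \<notin> underS \<kappa> \<nu>) co_small"
  using eventually_not_small small_underS by blast

lemma eventually_reindex:
  assumes "eventually P co_small" "bij_betw q (Field \<kappa>) (Field \<kappa>)"
  shows "eventually (\<lambda>\<alpha>. P (q \<alpha>)) co_small"
  unfolding eventually_co_small
  by (rule small_inj_vimage[OF assms(1)[unfolded eventually_co_small], of q])
    (use assms(2) in \<open>auto simp: bij_betw_def inj_on_def\<close>)

lemma small_bounded:
  assumes "C \<subseteq> Field \<kappa>" "|C| <o \<kappa>"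
  shows "\<exists>\<nu>\<in>Field \<kappa>. C \<subseteq> underS \<kappa> \<nu>"
proof -
  have "eventually (\<lambda>\<nu>. \<forall>c\<in>C. c \<in> underS \<kappa> \<nu>) co_small"
    by (rule eventually_small_ball[OF assms(2)]) (use assms(1) eventually_above in blast)
  then have "|{\<nu> \<in> Field \<kappa>. \<not> C \<subseteq> underS \<kappa> \<nu>}| <o \<kappa>"
    by (simp add: eventually_co_small subset_eq)
  from small_Field_Diff_Ex[OF this] show ?thesis by blast
qed

lemma small_Times_self: "|X| <o \<kappa> \<Longrightarrow> |X \<times> X| <o \<kappa>"
  by (rule card_of_subset_less[OF _ small_UN[of X "\<lambda>x. Pair x ` X"]]) (auto intro: small_image)

text \<open>Supplies the two halves of \<kappa>; the half tagged \<open>True\<close> will be the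
  common transversal of all matchings.\<close>

lemma bij_Times_bool:
  obtains p :: "'k \<times> bool \<Rightarrow> 'k" where "bij_betw p (Field \<kappa> \<times> UNIV) (Field \<kappa>)"
proof -
  have F: "|Field \<kappa>| \<le>o \<kappa>" using card_Field ordIso_imp_ordLeq by blast
  have "|Field \<kappa> \<times> (UNIV :: bool set)| \<le>o \<kappa>"
    by (rule card_of_Times_le[OF Cinfinite F finite_card_of_le[OF Cinfinite]]) simp
  then have "|Field \<kappa> \<times> (UNIV :: bool set)| \<le>o |Field \<kappa>|"
    using card_Field ordIso_symmetric ordLeq_ordIso_trans by blast
  moreover have "|Field \<kappa>| \<le>o |Field \<kappa> \<times> (UNIV :: bool set)|"
    by (rule card_of_ordLeqI[of "\<lambda>\<nu>. (\<nu>, True)"]) (auto simp: inj_on_def)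
  ultimately have "|Field \<kappa> \<times> (UNIV :: bool set)| =o |Field \<kappa>|"
    by (simp add: ordIso_iff_ordLeq)
  then show thesis using that unfolding card_of_ordIso[symmetric] by blast
qed

lemma small_complement:
  assumes "|{\<nu> \<in> Field \<kappa>. \<not> R \<nu>}| <o \<kappa>"
  shows "\<not> |{\<nu> \<in> Field \<kappa>. R \<nu>}| <o \<kappa>"
proof
  assume "|{\<nu> \<in> Field \<kappa>. R \<nu>}| <o \<kappa>"
  from small_Field_Diff_Ex[OF small_Un[OF this assms]] show False by blast
qed

text \<open>A maximal admissible \<open>K\<close> cannot be small: the sets
  \<open>Y \<alpha>\<close> and the initial segments belonging to a small \<open>K\<close> have a
  small union, so some point of \<open>B\<close> lies above \<open>K\<close> and has its
  \<open>y\<close>-value outside all these \<open>Y \<alpha>\<close>. Since the condition only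
  restricts later points against earlier ones, adding such a top point creates no conflict with
  \<open>K\<close>.\<close>

lemma sparse_subset:
  assumes B: "B \<subseteq> Field \<kappa>" "\<not> |B| <o \<kappa>" and Y: "\<And>\<alpha>. \<alpha> \<in> B \<Longrightarrow> |Y \<alpha>| <o \<kappa>"
    and y: "inj_on y B"
  shows "\<exists>K\<subseteq>B. \<not> |K| <o \<kappa> \<and> (\<forall>\<alpha>\<in>K. \<forall>\<alpha>'\<in>K. \<alpha> \<in> underS \<kappa> \<alpha>' \<longrightarrow> y \<alpha>' \<notin> Y \<alpha>)"
proof -
  let ?C = "{K. K \<subseteq> B \<and> (\<forall>\<alpha>\<in>K. \<forall>\<alpha>'\<in>K. \<alpha> \<in> underS \<kappa> \<alpha>' \<longrightarrow> y \<alpha>' \<notin> Y \<alpha>)}"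
  have "\<exists>K\<in>?C. \<forall>K'\<in>?C. K \<subseteq> K' \<longrightarrow> K' = K"
  proof (rule subset_Zorn_nonempty)
    have "{} \<in> ?C" by simp
    then show "?C \<noteq> {}" by blast
    fix \<C> assume "\<C> \<noteq> {}" and \<C>: "subset.chain ?C \<C>"
    have "y \<alpha>' \<notin> Y \<alpha>"
      if "K \<in> \<C>" "\<alpha> \<in> K" "K' \<in> \<C>" "\<alpha>' \<in> K'" "\<alpha> \<in> underS \<kappa> \<alpha>'" for K K' \<alpha> \<alpha>'
    proof -
      have "K \<subseteq> K' \<or> K' \<subseteq> K" using \<C> that(1,3) by (auto simp: subset_chain_def)
      moreover have "K \<in> ?C" "K' \<in> ?C" using \<C> that(1,3) by (auto simp: subset_chain_def)
      ultimately show ?thesis using that by blast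
    qed
    then show "\<Union>\<C> \<in> ?C" using \<C> by (auto simp: subset_chain_def)
  qed
  then obtain K where K: "K \<in> ?C" and max: "\<forall>K'\<in>?C. K \<subseteq> K' \<longrightarrow> K' = K" ..
  have "\<not> |K| <o \<kappa>"
  proof
    assume small: "|K| <o \<kappa>"
    have "|\<Union>\<alpha>\<in>K. Y \<alpha>| <o \<kappa>" using K Y by (intro small_UN[OF small]) blast
    then have "|{\<alpha> \<in> B. y \<alpha> \<in> (\<Union>\<alpha>\<in>K. Y \<alpha>)}| <o \<kappa>"
      by (rule small_inj_vimage[of _ y]) (use y in \<open>auto simp: inj_on_def\<close>)
    moreover have "|\<Union>\<alpha>\<in>K. underS \<kappa> \<alpha>| <o \<kappa>" by (intro small_UN[OF small] small_underS)
    ultimately have "|{\<alpha> \<in> B. y \<alpha> \<in> (\<Union>\<alpha>\<in>K. Y \<alpha>)} \<union> ((\<Union>\<alpha>\<in>K. underS \<kappa> \<alpha>) \<union> K)| <o \<kappa>"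
      using small by (intro small_Un)
    then have "\<not> B \<subseteq> {\<alpha> \<in> B. y \<alpha> \<in> (\<Union>\<alpha>\<in>K. Y \<alpha>)} \<union> ((\<Union>\<alpha>\<in>K. underS \<kappa> \<alpha>) \<union> K)"
      using B(2) card_of_subset_less by blast
    then obtain \<beta> where \<beta>: "\<beta> \<in> B" "\<And>\<alpha>. \<alpha> \<in> K \<Longrightarrow> y \<beta> \<notin> Y \<alpha>" "\<And>\<alpha>. \<alpha> \<in> K \<Longrightarrow> \<beta> \<notin> underS \<kappa> \<alpha>" "\<beta> \<notin> K"
      by blast
    have "\<beta> \<notin> underS \<kappa> \<beta>" by (simp add: underS_def)
    then have "insert \<beta> K \<in> ?C" using K \<beta> by blast
    with max have "insert \<beta> K = K" by (meson bspec subset_insertI)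
    with \<beta>(4) show False by blast
  qed
  then show ?thesis using K by blast
qed

text \<open>Membership of \<alpha> is decided by recursion, from the part of \<open>D\<close>
  already decided below \<alpha>. This is the diagonal construction that later defeats a lift with
  small supports.\<close>

lemma diagonal_subset: "\<exists>D\<subseteq>K. \<forall>\<alpha>\<in>K. \<alpha> \<in> D \<longleftrightarrow> R (D \<inter> underS \<kappa> \<alpha>) \<alpha>"
proof -
  have "\<exists>d. \<forall>\<alpha>. d \<alpha> = R {\<beta> \<in> K. d \<beta> \<and> \<beta> \<in> underS \<kappa> \<alpha>} \<alpha>"
  proof (rule dependent_wf_choice[where R = "\<kappa> - Id"])
    show "wf (\<kappa> - Id)" using wo_rel.WELL[OF wo] unfolding well_order_on_def by blast
    fix d d' :: "'k \<Rightarrow> bool" and \<alpha> v assume "\<And>\<beta>. (\<beta>, \<alpha>) \<in> \<kappa> - Id \<Longrightarrow> d \<beta> = d' \<beta>"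
    then have "{\<beta> \<in> K. d \<beta> \<and> \<beta> \<in> underS \<kappa> \<alpha>} = {\<beta> \<in> K. d' \<beta> \<and> \<beta> \<in> underS \<kappa> \<alpha>}"
      by (auto simp: underS_def)
    then show "(v = R {\<beta> \<in> K. d \<beta> \<and> \<beta> \<in> underS \<kappa> \<alpha>} \<alpha>) = (v = R {\<beta> \<in> K. d' \<beta> \<and> \<beta> \<in> underS \<kappa> \<alpha>} \<alpha>)"
      by simp
  qed blast
  then obtain d where d: "\<And>\<alpha>. d \<alpha> = R {\<beta> \<in> K. d \<beta> \<and> \<beta> \<in> underS \<kappa> \<alpha>} \<alpha>" by blast
  have "\<alpha> \<in> {\<beta> \<in> K. d \<beta>} \<longleftrightarrow> R ({\<beta> \<in> K. d \<beta>} \<inter> underS \<kappa> \<alpha>) \<alpha>" if "\<alpha> \<in> K" for \<alpha>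
  proof -
    have "{\<beta> \<in> K. d \<beta>} \<inter> underS \<kappa> \<alpha> = {\<beta> \<in> K. d \<beta> \<and> \<beta> \<in> underS \<kappa> \<alpha>}" by blast
    then show ?thesis using that d[of \<alpha>] by simp
  qed
  then show ?thesis by (intro exI[of _ "{\<beta> \<in> K. d \<beta>}"]) auto
qed

end

section \<open>Coherent matchings\<close>

text \<open>Pairs are oriented and no first entry is ever a second entry, so the pairs are disjoint
  transpositions, each listed once. The orientation says which point is tested for its support (the
  first) and which must avoid that support (the second).\<close>

definition matching :: "('a \<times> 'a) set \<Rightarrow> bool" where
  "matching M \<longleftrightarrow> (\<forall>(x, y)\<in>M. x \<noteq> y \<and>
     (\<forall>(x', y')\<in>M. x \<noteq> y' \<and> (x = x' \<longleftrightarrow> y = y')))"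

text \<open>\<open>H\<close> is what a slalom predicts on one block. Pairs added after the stage of
  \<open>M\<close> must be invisible to every sequence \<open>s\<close> predicted there; the
  relations \<open>Z\<close> are dealt with once, by the pair added at that stage itself.\<close>

definition coheres :: "(('t \<Rightarrow> 'b) \<times> 'z) set \<Rightarrow> ('t \<times> 't) set \<Rightarrow> ('t \<times> 't) set \<Rightarrow> bool" where
  "coheres H M M' \<longleftrightarrow> M \<subseteq> M' \<and> (\<forall>(x, y)\<in>M' - M. \<forall>(s, Z)\<in>H. s x = s y)"

lemma pigeonhole_fibre:
  assumes r: "Cinfinite r" and TX: "|h ` T| \<le>o r" and T: "\<not> |T| \<le>o r" and gr: "g \<le>o r"
  shows "\<exists>c\<in>h ` T. \<not> |{t \<in> T. h t = c}| \<le>o g"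
proof (rule ccontr)
  assume "\<not> ?thesis"
  then have "|\<Union>c\<in>h ` T. {t \<in> T. h t = c}| \<le>o r"
    using gr ordLeq_transitive by (intro card_of_UN_le[OF r TX]) blast
  moreover have "(\<Union>c\<in>h ` T. {t \<in> T. h t = c}) = T" by auto
  ultimately show False using T by simp
qed

text \<open>There are at most 2^g evaluation profiles on \<open>L\<close>, so even after removing
  \<open>V\<close> some profile is shared by more than g points. Within that fibre x is arbitrary,
  and y only has to avoid at most g sets of size at most g. As x is picked before anything is known
  about the relations in \<open>R\<close>, avoidance is promised only for those whose section at x
  is small.\<close>

lemma fresh_pair:
  assumes g: "Cinfinite g" and fg: "\<not> |T| \<le>o ctwo ^c g"
    and V: "|V| \<le>o g" and L: "|L| \<le>o g" and X: "|X| \<le>o g"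
    and LX: "L \<subseteq> T \<rightarrow> X"
    and R: "|R| \<le>o g"
  obtains x y where "x \<in> T - V" "y \<in> T - V" "x \<noteq> y" "\<And>s. s \<in> L \<Longrightarrow> s x = s y"
    "\<And>Z. Z \<in> R \<Longrightarrow> |Z `` {x}| \<le>o g \<Longrightarrow> (x, y) \<notin> Z"
proof -
  \<comment> \<open>The profile of \<open>t\<close> is the graph of evaluation at \<open>t\<close>,
    a subset of \<open>L \<times> X\<close>; equal profiles mean that no \<open>s\<close> in
    \<open>L\<close> separates the points.\<close>
  define h where "h t = (\<lambda>s. (s, s t)) ` L" for t
  have g2: "Cinfinite (ctwo ^c g)"
    by (rule Cinfinite_cexp) (use g in \<open>auto intro: ordLeq_refl Card_order_ctwo\<close>)
  have g_le: "g \<le>o ctwo ^c g"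
    using g ordLess_ctwo_cexp ordLess_imp_ordLeq by blast
  have "\<not> |T - V| \<le>o ctwo ^c g"
  proof
    assume "|T - V| \<le>o ctwo ^c g"
    from card_of_Un_le[OF g2 this ordLeq_transitive[OF V g_le]] have "|T \<union> V| \<le>o ctwo ^c g" by simp
    then show False using fg card_of_subset_le[of T "T \<union> V"] by blast
  qed
  moreover have "h ` (T - V) \<subseteq> Pow (L \<times> X)"
    unfolding h_def using LX by fast
  then have "|h ` (T - V)| \<le>o ctwo ^c g"
    by (rule card_of_subset_le) (intro card_of_Pow_le_ctwo_cexp card_of_Times_le g L X)
  ultimately obtain c where c: "\<not> |{t \<in> T - V. h t = c}| \<le>o g"
    using pigeonhole_fibre[OF g2 _ _ g_le] by blast
  have "{t \<in> T - V. h t = c} \<noteq> {}"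
    using c finite_card_of_le[OF g, of "{}"] by (metis finite.emptyI)
  then obtain x where x: "x \<in> T - V" "h x = c" by blast
  \<comment> \<open>Everything that \<open>y\<close> has to avoid once \<open>x\<close> is fixed;
    its size is at most \<open>g\<close>, so it cannot exhaust the fibre.\<close>
  define W where "W = insert x (\<Union>Z\<in>{Z \<in> R. |Z `` {x}| \<le>o g}. Z `` {x})"
  have "|\<Union>Z\<in>{Z \<in> R. |Z `` {x}| \<le>o g}. Z `` {x}| \<le>o g"
    by (rule card_of_UN_le[OF g]) (auto intro: card_of_subset_le[OF _ R])
  then have "|W| \<le>o g"
    using card_of_Un_le[OF g finite_card_of_le[OF g, of "{x}"]] unfolding W_def by simp
  then have "\<not> {t \<in> T - V. h t = c} \<subseteq> W"
    using c card_of_subset_le by blast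
  then obtain y where y: "y \<in> T - V" "h y = c" "y \<notin> W" by blast
  show ?thesis
  proof
    show "s x = s y" if "s \<in> L" for s
    proof -
      have "(s, s x) \<in> h y" using that x(2) y(2) unfolding h_def by auto
      then show ?thesis unfolding h_def by auto
    qed
    show "(x, y) \<notin> Z" if "Z \<in> R" "|Z `` {x}| \<le>o g" for Z
      using y(3) that unfolding W_def by blast
  qed (use x y W_def in auto)
qed

lemma matching_Union_chain:
  assumes "\<And>M. M \<in> \<M> \<Longrightarrow> matching M" "\<And>M M'. M \<in> \<M> \<Longrightarrow> M' \<in> \<M> \<Longrightarrow> M \<subseteq> M' \<or> M' \<subseteq> M"
  shows "matching (\<Union>\<M>)"
  unfolding matching_def
proof (intro ballI, clarify)
  fix x y M assume xy: "(x, y) \<in> M" "M \<in> \<M>"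
  have "x \<noteq> y' \<and> (x = x' \<longleftrightarrow> y = y')" if p: "(x', y') \<in> M'" "M' \<in> \<M>" for x' y' M'
  proof -
    obtain N where "N \<in> \<M>" "(x, y) \<in> N" "(x', y') \<in> N"
      using assms(2)[OF xy(2) p(2)] xy p by blast
    then show ?thesis using assms(1)[of N] unfolding matching_def by fast
  qed
  moreover have "x \<noteq> y" using assms(1)[OF xy(2)] xy(1) unfolding matching_def by fast
  ultimately show "x \<noteq> y \<and> (\<forall>(x', y')\<in>\<Union>\<M>. x \<noteq> y' \<and> (x = x' \<longleftrightarrow> y = y'))" by blast
qed

lemma matching_insert:
  assumes "matching M" "x \<noteq> y" "x \<notin> Field M" "y \<notin> Field M"
  shows "matching (insert (x, y) M)"
proof -
  have new: "u \<noteq> x \<and> u \<noteq> y \<and> v \<noteq> x \<and> v \<noteq> y" if "(u, v) \<in> M" for u v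
    using that assms(3,4) by (auto intro: FieldI1 FieldI2)
  have old: "u \<noteq> v \<and> u \<noteq> v' \<and> (u = u' \<longleftrightarrow> v = v')" if "(u, v) \<in> M" "(u', v') \<in> M" for u v u' v'
    using that assms(1) unfolding matching_def by fast
  have "u \<noteq> v \<and> u \<noteq> v' \<and> (u = u' \<longleftrightarrow> v = v')"
    if "(u, v) \<in> insert (x, y) M" "(u', v') \<in> insert (x, y) M" for u v u' v'
    using that new old[of u v u' v'] old[of u v u v] old[of u' v' u' v'] new[of u v] new[of u' v'] assms(2) by auto
  then show ?thesis unfolding matching_def by blast
qed

text \<open>One block of one stage, successor or limit alike. The union of the coherent earlier
  matchings is again a matching of size at most g, hence leaves room for one fresh pair, invisible
  to all earlier predictions and avoiding the small sections of the relations in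
  \<open>H0\<close>.\<close>

lemma coherent_extension:
  assumes g: "Cinfinite g" and fg: "\<not> |T| \<le>o ctwo ^c g" and X: "|X| \<le>o g"
    and P: "|P| \<le>o g"
    and m: "\<And>\<zeta>. \<zeta> \<in> P \<Longrightarrow> m \<zeta> \<subseteq> T \<times> T \<and> matching (m \<zeta>) \<and> |m \<zeta>| \<le>o g"
    and H: "\<And>\<zeta>. \<zeta> \<in> P \<Longrightarrow> |H \<zeta>| \<le>o g \<and> (\<forall>(s, Z)\<in>H \<zeta>. s \<in> T \<rightarrow> X)"
    and coh: "\<And>\<zeta> \<zeta>'. \<zeta> \<in> P \<Longrightarrow> \<zeta>' \<in> P \<Longrightarrow>
      coheres (H \<zeta>) (m \<zeta>) (m \<zeta>') \<or> coheres (H \<zeta>') (m \<zeta>') (m \<zeta>)"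
    and H0: "|H0| \<le>o g"
  shows "\<exists>M \<subseteq> T \<times> T. matching M \<and> |M| \<le>o g \<and> (\<forall>\<zeta>\<in>P. coheres (H \<zeta>) (m \<zeta>) M) \<and>
    (\<exists>(x, y)\<in>M. \<forall>(s, Z)\<in>H0. |Z `` {x}| \<le>o g \<longrightarrow> (x, y) \<notin> Z)"
proof -
  define M where "M = (\<Union>\<zeta>\<in>P. m \<zeta>)"
  have M: "|M| \<le>o g" unfolding M_def using m by (intro card_of_UN_le[OF g P]) blast
  have FM: "|Field M| \<le>o g"
    unfolding Field_def Domain_fst Range_snd by (intro card_of_Un_le[OF g] card_of_image_le M)
  have L: "|fst ` (\<Union>\<zeta>\<in>P. H \<zeta>)| \<le>o g"
    using H by (intro card_of_image_le card_of_UN_le[OF g P]) blast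
  have LX: "fst ` (\<Union>\<zeta>\<in>P. H \<zeta>) \<subseteq> T \<rightarrow> X"
    using H by fastforce
  obtain x y where xy: "x \<in> T - Field M" "y \<in> T - Field M" "x \<noteq> y"
    and eq: "\<And>s. s \<in> fst ` (\<Union>\<zeta>\<in>P. H \<zeta>) \<Longrightarrow> s x = s y"
    and new: "\<And>Z. Z \<in> snd ` H0 \<Longrightarrow> |Z `` {x}| \<le>o g \<Longrightarrow> (x, y) \<notin> Z"
    using fresh_pair[OF g fg FM L X LX, of "snd ` H0"] card_of_image_le[OF H0, of snd] by metis
  have "m \<zeta> \<subseteq> m \<zeta>' \<or> m \<zeta>' \<subseteq> m \<zeta>" if "\<zeta> \<in> P" "\<zeta>' \<in> P" for \<zeta> \<zeta>'
    using coh[OF that] unfolding coheres_def by blast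
  then have "matching M"
    unfolding M_def by (intro matching_Union_chain) (use m in blast)+
  then have "matching (insert (x, y) M)"
    using xy by (intro matching_insert) auto
  moreover have "insert (x, y) M \<subseteq> T \<times> T"
    using xy m unfolding M_def by auto
  moreover have "|insert (x, y) M| \<le>o g"
    using card_of_Un_le[OF g finite_card_of_le[OF g, of "{(x, y)}"] M] by simp
  moreover have "coheres (H \<zeta>) (m \<zeta>) (insert (x, y) M)" if \<zeta>: "\<zeta> \<in> P" for \<zeta>
  proof -
    have "s u = s v" if uv: "(u, v) \<in> insert (x, y) M - m \<zeta>" "(s, Z) \<in> H \<zeta>" for u v s Z
    proof (cases "(u, v) = (x, y)")
      case True
      then show ?thesis using eq[of s] uv(2) \<zeta> by force
    next
      case False
      then obtain \<zeta>' where "\<zeta>' \<in> P" "(u, v) \<in> m \<zeta>'" using uv(1) unfolding M_def by blast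
      \<comment> \<open>The pair belongs to \<open>m \<zeta>'\<close> but not to
        \<open>m \<zeta>\<close>, so \<open>m \<zeta>'\<close> is not contained in
        \<open>m \<zeta>\<close> and only the coherence of \<zeta> with the larger matching
        remains.\<close>
      then show ?thesis using coh[OF \<zeta>, of \<zeta>'] uv unfolding coheres_def by fast
    qed
    then show ?thesis using \<zeta> unfolding coheres_def M_def by blast
  qed
  moreover have "\<exists>(u, v)\<in>insert (x, y) M. \<forall>(s, Z)\<in>H0. |Z `` {u}| \<le>o g \<longrightarrow> (u, v) \<notin> Z"
    using new by force
  ultimately show ?thesis by blast
qed

section \<open>Consequences of the dagger hypothesis, from growth of g to slaloms\<close>

locale dagger_cardinal = regular_cardinal \<kappa> for \<kappa> :: "'k rel" +
  fixes f g :: "'k \<Rightarrow> 'k rel"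
  assumes dagger: "dagger \<kappa> f g"
begin

lemma f_Cinfinite: "\<nu> \<in> Field \<kappa> \<Longrightarrow> Cinfinite (f \<nu>)"
  and f_less: "\<nu> \<in> Field \<kappa> \<Longrightarrow> f \<nu> <o \<kappa>"
  and g_Cinfinite: "\<nu> \<in> Field \<kappa> \<Longrightarrow> Cinfinite (g \<nu>)"
  and ctwo_cexp_g_less: "\<nu> \<in> Field \<kappa> \<Longrightarrow> ctwo ^c g \<nu> <o f \<nu>"
  and underS_le_g: "\<nu>' \<in> Field \<kappa> \<Longrightarrow> \<nu> \<in> underS \<kappa> \<nu>' \<Longrightarrow> |underS \<kappa> \<nu>| \<le>o g \<nu>"
  and g_mono: "\<nu>' \<in> Field \<kappa> \<Longrightarrow> \<nu> \<in> underS \<kappa> \<nu>' \<Longrightarrow> g \<nu> \<le>o g \<nu>'"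
  and dnum: "dnum \<kappa> (\<lambda>\<nu>. ctwo ^c f \<nu>) g =o cardSuc \<kappa>"
  using dagger unfolding dagger_def by auto

text \<open>The hypothesis bounds |\<nu>| only when some \<nu>' lies above \<nu>; there always is
  one, because an infinite cardinal has no largest element.\<close>

lemma card_of_underS_le_g: "\<nu> \<in> Field \<kappa> \<Longrightarrow> |underS \<kappa> \<nu>| \<le>o g \<nu>"
  using infinite_Card_order_limit[OF Card_order, of \<nu>] Cinfinite underS_le_g
  unfolding cinfinite_def underS_def by blast

lemma card_of_Field_f: "\<nu> \<in> Field \<kappa> \<Longrightarrow> |Field (f \<nu>)| =o f \<nu>"
  using f_Cinfinite card_of_Field_ordIso by blast

lemma small_Field_f: "\<nu> \<in> Field \<kappa> \<Longrightarrow> |Field (f \<nu>)| <o \<kappa>"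
  using card_of_Field_f f_less ordIso_ordLess_trans by blast

lemma not_Field_f_le: "\<nu> \<in> Field \<kappa> \<Longrightarrow> \<not> |Field (f \<nu>)| \<le>o ctwo ^c g \<nu>"
  using ordLess_ordIso_trans[OF ctwo_cexp_g_less ordIso_symmetric[OF card_of_Field_f]]
    not_ordLess_ordLeq by blast

lemma g_le_f: "\<nu> \<in> Field \<kappa> \<Longrightarrow> g \<nu> \<le>o f \<nu>"
  using ordLess_transitive[OF ordLess_ctwo_cexp ctwo_cexp_g_less, of \<nu>] g_Cinfinite ordLess_imp_ordLeq
  by blast

text \<open>A copy of \<open>C\<close> inside \<kappa> is bounded by some \<nu>, whose own
  cardinality is at most g(\<nu>); monotonicity of g does the rest.\<close>

lemma eventually_card_le_g:
  assumes "|C| <o \<kappa>"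
  shows "eventually (\<lambda>\<nu>. |C| \<le>o g \<nu>) co_small"
proof -
  obtain B where B: "B \<subseteq> Field \<kappa>" "|C| =o |B|" "|B| <o \<kappa>"
    using assms internalize_card_of_ordLess[of C \<kappa>] by blast
  obtain \<nu>\<^sub>0 where \<nu>\<^sub>0: "\<nu>\<^sub>0 \<in> Field \<kappa>" "B \<subseteq> underS \<kappa> \<nu>\<^sub>0"
    using small_bounded[OF B(1,3)] by blast
  from eventually_above[OF \<nu>\<^sub>0(1)] eventually_Field show ?thesis
  proof eventually_elim
    case (elim \<nu>)
    have "|C| \<le>o |underS \<kappa> \<nu>\<^sub>0|"
      using B(2) card_of_mono1[OF \<nu>\<^sub>0(2)] by (rule ordIso_ordLeq_trans)
    also have "|underS \<kappa> \<nu>\<^sub>0| \<le>o g \<nu>\<^sub>0" by (rule card_of_underS_le_g[OF \<nu>\<^sub>0(1)])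
    also have "g \<nu>\<^sub>0 \<le>o g \<nu>" by (rule g_mono[OF elim(2,1)])
    finally show ?case .
  qed
qed

text \<open>Slalom values must have size exactly g(\<nu>), so the point is added to a set that
  already has this size; it exists because g(\<nu>) is at most 2^f(\<nu>).\<close>

lemma ex_subset_of_card:
  assumes "\<nu> \<in> Field \<kappa>" "p \<in> Field (ctwo ^c f \<nu>)"
  shows "\<exists>A \<in> subsets_of_card (Field (ctwo ^c f \<nu>)) (g \<nu>). p \<in> A"
proof -
  note g = g_Cinfinite[OF assms(1)]
  have "|Field (g \<nu>)| =o g \<nu>" using g card_of_Field_ordIso by blast
  moreover have "g \<nu> \<le>o ctwo ^c f \<nu>"
    using g_le_f[OF assms(1)] ordLess_ctwo_cexp[of "f \<nu>"] f_Cinfinite[OF assms(1)]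
      ordLeq_ordLess_trans ordLess_imp_ordLeq by blast
  ultimately have "|Field (g \<nu>)| \<le>o ctwo ^c f \<nu>" by (rule ordIso_ordLeq_trans)
  then obtain B where B: "B \<subseteq> Field (ctwo ^c f \<nu>)" "|Field (g \<nu>)| =o |B|"
    using internalize_card_of_ordLeq[of "Field (g \<nu>)" "ctwo ^c f \<nu>"] by blast
  have gB: "g \<nu> =o |B|"
    using \<open>|Field (g \<nu>)| =o g \<nu>\<close> B(2) ordIso_symmetric ordIso_transitive by blast
  then have "|insert p B| \<le>o g \<nu>"
    using card_of_Un_le[OF g finite_card_of_le[OF g, of "{p}"], of B]
      ordIso_imp_ordLeq[OF ordIso_symmetric[OF gB]] by simp
  moreover have "g \<nu> \<le>o |insert p B|"
    using gB card_of_mono1[of B "insert p B"] ordIso_ordLeq_trans by blast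
  ultimately have "insert p B \<in> subsets_of_card (Field (ctwo ^c f \<nu>)) (g \<nu>)"
    unfolding subsets_of_card_def using B(1) assms(2) ordIso_iff_ordLeq by blast
  then show ?thesis by blast
qed

text \<open>The full product of slaloms covers. This guarantees that the minimum behind
  \<open>dnum\<close> ranges over a nonempty class.\<close>

lemma ex_eventually_covering: "\<exists>D. eventually_covering \<kappa> (\<lambda>\<nu>. ctwo ^c f \<nu>) g D"
proof
  let ?D = "\<Pi>\<^sub>E \<nu>\<in>Field \<kappa>. subsets_of_card (Field (ctwo ^c f \<nu>)) (g \<nu>)"
  show "eventually_covering \<kappa> (\<lambda>\<nu>. ctwo ^c f \<nu>) g ?D"
    unfolding eventually_covering_def
  proof (intro conjI ballI subset_refl)
    fix F assume F: "F \<in> (\<Pi>\<^sub>E \<nu>\<in>Field \<kappa>. Field (ctwo ^c f \<nu>))"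
    have "\<forall>\<nu>\<in>Field \<kappa>. \<exists>A. A \<in> subsets_of_card (Field (ctwo ^c f \<nu>)) (g \<nu>) \<and> F \<nu> \<in> A"
      using F ex_subset_of_card by blast
    then obtain A where A: "\<forall>\<nu>\<in>Field \<kappa>.
        A \<nu> \<in> subsets_of_card (Field (ctwo ^c f \<nu>)) (g \<nu>) \<and> F \<nu> \<in> A \<nu>"
      by metis
    obtain \<beta> where "\<beta> \<in> Field \<kappa>" using small_Field_Diff_Ex[of "{}"] small_finite by blast
    with A show "\<exists>G\<in>?D. \<exists>\<beta>\<in>Field \<kappa>. \<forall>\<nu>\<in>Field \<kappa> - underS \<kappa> \<beta>. F \<nu> \<in> G \<nu>"
      by (intro bexI[of _ "restrict A (Field \<kappa>)"] bexI[of _ \<beta>]) auto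
  qed
qed

text \<open>Cardinals are well-ordered, so the minimum behind \<open>dnum\<close> is attained and
  the family picked by its choice operator really is covering.\<close>

lemma small_covering:
  obtains D where "eventually_covering \<kappa> (\<lambda>\<nu>. ctwo ^c f \<nu>) g D" "|D| =o cardSuc \<kappa>"
proof -
  let ?C = "eventually_covering \<kappa> (\<lambda>\<nu>. ctwo ^c f \<nu>) g"
  let ?min = "\<lambda>D. ?C D \<and> (\<forall>D'. ?C D' \<longrightarrow> |D| \<le>o |D'| )"
  have "\<exists>r\<in>card_of ` Collect ?C. \<forall>r'\<in>card_of ` Collect ?C. r \<le>o r'"
    by (rule exists_minim_Card_order) (use ex_eventually_covering in \<open>auto simp: card_of_Card_order\<close>)
  then have "\<exists>D. ?min D" by blast
  then have "?min (SOME D. ?min D)" by (rule someI_ex)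
  moreover have "|SOME D. ?min D| =o cardSuc \<kappa>"
    using dnum unfolding dnum_def .
  ultimately show ?thesis using that by blast
qed

text \<open>
  What a slalom has to predict on the \<open>\<nu>\<close>-th block: a sequence of values, and a relation assigning to
  each point of the block the part of a support that lies in the block.
\<close>

definition code_dom :: "'b set \<Rightarrow> 'k \<Rightarrow> (('k \<Rightarrow> 'b) \<times> ('k \<times> 'k) set) set" where
  "code_dom X \<nu> = (Field (f \<nu>) \<rightarrow>\<^sub>E X) \<times> Pow (Field (f \<nu>) \<times> Field (f \<nu>))"

text \<open>A sequence is determined by its graph, a subset of a product of size at most f(\<nu>),
  and so is a relation on the block; both kinds of object are therefore counted by
  2^f(\<nu>).\<close>

lemma card_code_dom:
  assumes \<nu>: "\<nu> \<in> Field \<kappa>" and X: "|X| \<le>o g \<nu>"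
  shows "|code_dom X \<nu>| \<le>o ctwo ^c f \<nu>"
proof -
  note f = f_Cinfinite[OF \<nu>]
  let ?T = "Field (f \<nu>)"
  have T: "|?T| \<le>o f \<nu>" using card_of_Field_f[OF \<nu>] ordIso_imp_ordLeq by blast
  have f2: "Cinfinite (ctwo ^c f \<nu>)"
    by (rule Cinfinite_cexp) (use f in \<open>auto intro: ordLeq_refl Card_order_ctwo\<close>)
  let ?G = "\<lambda>s. (\<lambda>t. (t, s t)) ` ?T"
  have "inj_on ?G (?T \<rightarrow>\<^sub>E X)"
  proof (rule inj_onI, rule PiE_ext)
    fix s s' t assume "?G s = ?G s'" "t \<in> ?T"
    then show "s t = s' t" by auto
  qed
  moreover have "?G ` (?T \<rightarrow>\<^sub>E X) \<subseteq> Pow (?T \<times> X)" by auto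
  ultimately have "|?T \<rightarrow>\<^sub>E X| \<le>o |Pow (?T \<times> X)|" by (intro card_of_ordLeqI[of ?G]) auto
  moreover have "|Pow (?T \<times> X)| \<le>o ctwo ^c f \<nu>"
    by (intro card_of_Pow_le_ctwo_cexp card_of_Times_le f T ordLeq_transitive[OF X g_le_f[OF \<nu>]])
  ultimately have "|?T \<rightarrow>\<^sub>E X| \<le>o ctwo ^c f \<nu>" by (rule ordLeq_transitive)
  then show ?thesis
    unfolding code_dom_def
    by (intro card_of_Times_le[OF f2] card_of_Pow_le_ctwo_cexp card_of_Times_le f T)
qed

text \<open>The covering family itself serves as the set of stages, ordered by its cardinal
  well-order of type the successor of \<kappa>; hence proper initial segments have size at most
  \<kappa>. The index type arises because elements of \<open>ctwo ^c f \<nu>\<close> are functions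
  into \<open>bool\<close>. Each slalom is pulled back along injections of the codes.\<close>

lemma slaloms:
  fixes X :: "'b set"
  assumes X: "|X| <o \<kappa>"
  obtains r :: "('k \<Rightarrow> ('k \<Rightarrow> bool) set) rel"
    and H :: "('k \<Rightarrow> ('k \<Rightarrow> bool) set) \<Rightarrow> 'k \<Rightarrow> (('k \<Rightarrow> 'b) \<times> ('k \<times> 'k) set) set"
  where "Well_order r" "\<And>\<xi>. |underS r \<xi>| \<le>o \<kappa>"
    "\<And>\<xi> \<nu>. \<nu> \<in> Field \<kappa> \<Longrightarrow> |H \<xi> \<nu>| \<le>o g \<nu>" "\<And>\<xi> \<nu>. H \<xi> \<nu> \<subseteq> code_dom X \<nu>"
    "\<And>F. F \<in> (\<Pi> \<nu>\<in>Field \<kappa>. code_dom X \<nu>) \<Longrightarrow>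
      \<exists>\<xi>\<in>Field r. eventually (\<lambda>\<nu>. F \<nu> \<in> H \<xi> \<nu>) co_small"
proof -
  obtain D where D: "eventually_covering \<kappa> (\<lambda>\<nu>. ctwo ^c f \<nu>) g D" "|D| =o cardSuc \<kappa>"
    using small_covering by blast
  let ?S = "\<lambda>\<nu>. Field (ctwo ^c f \<nu>)"
  let ?N = "{\<nu> \<in> Field \<kappa>. |X| \<le>o g \<nu>}"
  have "\<exists>c. inj_on c (code_dom X \<nu>) \<and> c ` code_dom X \<nu> \<subseteq> ?S \<nu>" if "\<nu> \<in> ?N" for \<nu>
    using card_code_dom[of \<nu> X] that
    by (simp add: cexp_def Field_card_of card_of_ordLeq)
  then have "\<forall>\<nu>\<in>?N. \<exists>c. inj_on c (code_dom X \<nu>) \<and> c ` code_dom X \<nu> \<subseteq> ?S \<nu>" by blast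
  from bchoice[OF this] obtain c
    where c: "\<forall>\<nu>\<in>?N. inj_on (c \<nu>) (code_dom X \<nu>) \<and> c \<nu> ` code_dom X \<nu> \<subseteq> ?S \<nu>" ..
  \<comment> \<open>Nothing is predicted on blocks where \<open>X\<close> exceeds g(\<nu>) and codes
    need not embed; there are few such blocks.\<close>
  define H where "H \<xi> \<nu> = {p \<in> code_dom X \<nu>. \<nu> \<in> ?N \<and> \<xi> \<in> D \<and> c \<nu> p \<in> \<xi> \<nu>}" for \<xi> \<nu>
  show thesis
  proof
    show "Well_order |D|" by (rule card_of_Well_order)
    fix \<xi>
    show "|underS |D| \<xi>| \<le>o \<kappa>"
    proof (cases "\<xi> \<in> D")
      case True
      have "|underS |D| \<xi>| <o |D|"
        using card_of_underS[OF card_of_Card_order] True by (simp add: Field_card_of)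
      then have "|underS |D| \<xi>| <o cardSuc \<kappa>" using D(2) ordLess_ordIso_trans by blast
      then show ?thesis using cardSuc_ordLeq_ordLess[OF Card_order card_of_Card_order] by blast
    next
      case False
      then have "underS |D| \<xi> = {}"
        using FieldI2[of _ \<xi> "|D|"] by (auto simp: underS_def Field_card_of)
      then show ?thesis using finite_card_of_le[OF Cinfinite, of "{}"] by simp
    qed
    fix \<nu>
    show "H \<xi> \<nu> \<subseteq> code_dom X \<nu>" unfolding H_def by blast
    show "|H \<xi> \<nu>| \<le>o g \<nu>" if \<nu>: "\<nu> \<in> Field \<kappa>"
    proof (cases "\<nu> \<in> ?N \<and> \<xi> \<in> D")
      case True
      then have "\<xi> \<nu> \<in> subsets_of_card (?S \<nu>) (g \<nu>)"
        using D(1) \<nu> unfolding eventually_covering_def by blast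
      then have "|\<xi> \<nu>| \<le>o g \<nu>" unfolding subsets_of_card_def using ordIso_imp_ordLeq by blast
      moreover have "|H \<xi> \<nu>| \<le>o |\<xi> \<nu>|"
        using bspec[OF c, of \<nu>] True unfolding H_def by (intro card_of_ordLeqI[of "c \<nu>"]) (auto simp: inj_on_def)
      ultimately show ?thesis by (rule ordLeq_transitive[rotated])
    next
      case False
      then have "H \<xi> \<nu> = {}" unfolding H_def by blast
      then show ?thesis using finite_card_of_le[OF g_Cinfinite[OF \<nu>], of "{}"] by simp
    qed
  next
    fix F assume "F \<in> (\<Pi> \<nu>\<in>Field \<kappa>. code_dom X \<nu>)"
    then have F: "\<And>\<nu>. \<nu> \<in> Field \<kappa> \<Longrightarrow> F \<nu> \<in> code_dom X \<nu>" by blast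
    \<comment> \<open>Blocks without an embedding receive an arbitrary element, only to make
      \<open>F'\<close> a member of the product.\<close>
    define F' where "F' = (\<lambda>\<nu>\<in>Field \<kappa>. if \<nu> \<in> ?N then c \<nu> (F \<nu>) else (SOME p. p \<in> ?S \<nu>))"
    have "(SOME p. p \<in> ?S \<nu>) \<in> ?S \<nu>" if "\<nu> \<in> Field \<kappa>" for \<nu>
    proof -
      have "(\<lambda>t. if t \<in> Field (f \<nu>) then True else undefined) \<in> ?S \<nu>"
        by (auto simp: cexp_def Field_card_of Func_def ctwo_def)
      then have "\<exists>p. p \<in> ?S \<nu>" by blast
      then show ?thesis by (rule someI_ex)
    qed
    then have "F' \<in> (\<Pi>\<^sub>E \<nu>\<in>Field \<kappa>. ?S \<nu>)"
      unfolding F'_def using c F by (auto simp: image_subset_iff)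
    then obtain G \<beta> where G: "G \<in> D" "\<forall>\<nu>\<in>Field \<kappa> - underS \<kappa> \<beta>. F' \<nu> \<in> G \<nu>"
      using D(1) unfolding eventually_covering_def by blast
    from eventually_card_le_g[OF X] eventually_ge[of \<beta>] eventually_Field
    have "eventually (\<lambda>\<nu>. F \<nu> \<in> H G \<nu>) co_small"
    proof eventually_elim
      case (elim \<nu>)
      then have "c \<nu> (F \<nu>) \<in> G \<nu>" using G(2) unfolding F'_def by force
      then show ?case using elim F G(1) unfolding H_def by blast
    qed
    then show "\<exists>\<xi>\<in>Field |D|. eventually (\<lambda>\<nu>. F \<nu> \<in> H \<xi> \<nu>) co_small"
      using G(1) by (auto simp: Field_card_of)
  qed
qed

text \<open>Up to \<kappa> earlier stages have to be continued, while a single block can serve only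
  g(\<nu>) of them. Coherence is required only for almost all blocks, so the stages are enumerated
  in type \<kappa> and block \<nu> serves only some of those with index below \<nu>.\<close>

lemma coherent_matchings_step:
  fixes H :: "'d \<Rightarrow> 'k \<Rightarrow> (('k \<Rightarrow> 'b) \<times> ('k \<times> 'k) set) set"
  assumes X: "|X| <o \<kappa>" and Q: "|Q| \<le>o \<kappa>"
    and H: "\<And>\<xi> \<nu>. \<nu> \<in> Field \<kappa> \<Longrightarrow> |H \<xi> \<nu>| \<le>o g \<nu>" "\<And>\<xi> \<nu>. H \<xi> \<nu> \<subseteq> code_dom X \<nu>"
    and m: "\<And>\<zeta> \<nu>. \<zeta> \<in> Q \<Longrightarrow> \<nu> \<in> Field \<kappa> \<Longrightarrow>
      m \<zeta> \<nu> \<subseteq> Field (f \<nu>) \<times> Field (f \<nu>) \<and> matching (m \<zeta> \<nu>) \<and> |m \<zeta> \<nu>| \<le>o g \<nu>"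
    and coh: "\<And>\<zeta> \<zeta>'. \<zeta> \<in> Q \<Longrightarrow> \<zeta>' \<in> Q \<Longrightarrow>
      eventually (\<lambda>\<nu>. coheres (H \<zeta> \<nu>) (m \<zeta> \<nu>) (m \<zeta>' \<nu>) \<or> coheres (H \<zeta>' \<nu>) (m \<zeta>' \<nu>) (m \<zeta> \<nu>)) co_small"
  shows "\<exists>M. (\<forall>\<nu>\<in>Field \<kappa>. M \<nu> \<subseteq> Field (f \<nu>) \<times> Field (f \<nu>) \<and> matching (M \<nu>) \<and> |M \<nu>| \<le>o g \<nu>) \<and>
    (\<forall>\<zeta>\<in>Q. eventually (\<lambda>\<nu>. coheres (H \<zeta> \<nu>) (m \<zeta> \<nu>) (M \<nu>)) co_small) \<and>
    eventually (\<lambda>\<nu>. \<exists>(x, y)\<in>M \<nu>. \<forall>(s, Z)\<in>H \<xi> \<nu>. |Z `` {x}| \<le>o g \<nu> \<longrightarrow> (x, y) \<notin> Z) co_small"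
proof -
  have "|Q| \<le>o |Field \<kappa>|" using Q card_Field ordIso_symmetric ordLeq_ordIso_trans by blast
  then obtain e where e: "inj_on e Q" "e ` Q \<subseteq> Field \<kappa>"
    unfolding card_of_ordLeq[symmetric] by blast
  define C where "C \<zeta> \<zeta>' \<nu> \<longleftrightarrow>
    coheres (H \<zeta> \<nu>) (m \<zeta> \<nu>) (m \<zeta>' \<nu>) \<or> coheres (H \<zeta>' \<nu>) (m \<zeta>' \<nu>) (m \<zeta> \<nu>)" for \<zeta> \<zeta>' \<nu>
  \<comment> \<open>The stages whose index is below \<open>\<nu>\<close> and up to which everything is already coherent at \<open>\<nu>\<close>.
    Every stage belongs to \<open>P \<nu>\<close> for almost all \<open>\<nu>\<close>.\<close>
  define P where "P \<nu> = {\<zeta> \<in> Q. e \<zeta> \<in> underS \<kappa> \<nu> \<and>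
    (\<forall>\<zeta>\<^sub>1\<in>{\<zeta>' \<in> Q. (e \<zeta>', e \<zeta>) \<in> \<kappa>}. \<forall>\<zeta>\<^sub>2\<in>{\<zeta>' \<in> Q. (e \<zeta>', e \<zeta>) \<in> \<kappa>}. C \<zeta>\<^sub>1 \<zeta>\<^sub>2 \<nu>)}" for \<nu>
  have P_card: "|P \<nu>| \<le>o g \<nu>" if "\<nu> \<in> Field \<kappa>" for \<nu>
  proof -
    have "|P \<nu>| \<le>o |underS \<kappa> \<nu>|"
      using inj_on_subset[OF e(1), of "P \<nu>"]
      by (intro card_of_ordLeqI[of e]) (auto simp: P_def)
    then show ?thesis using card_of_underS_le_g[OF that] ordLeq_transitive by blast
  qed
  have P_coh: "C \<zeta> \<zeta>' \<nu>" if "\<zeta> \<in> P \<nu>" "\<zeta>' \<in> P \<nu>" for \<zeta> \<zeta>' \<nu>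
  proof -
    have "\<zeta> \<in> Q" "\<zeta>' \<in> Q" using that unfolding P_def by auto
    then have F: "e \<zeta> \<in> Field \<kappa>" "e \<zeta>' \<in> Field \<kappa>" using e(2) by auto
    then have "(e \<zeta>, e \<zeta>) \<in> \<kappa>" "(e \<zeta>', e \<zeta>') \<in> \<kappa>"
      using wo_rel.REFL[OF wo] unfolding refl_on_def by auto
    \<comment> \<open>Whichever of the two stages has the larger index carries the coherence of both
      in its own membership of \<open>P \<nu>\<close>.\<close>
    moreover have "(e \<zeta>, e \<zeta>') \<in> \<kappa> \<or> (e \<zeta>', e \<zeta>) \<in> \<kappa>"
      using F wo_rel.TOTALS[OF wo] by blast
    ultimately show ?thesis
      using that \<open>\<zeta> \<in> Q\<close> \<open>\<zeta>' \<in> Q\<close> unfolding P_def by blast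
  qed
  have P_ev: "eventually (\<lambda>\<nu>. \<zeta> \<in> P \<nu>) co_small" if \<zeta>: "\<zeta> \<in> Q" for \<zeta>
  proof -
    let ?A = "{\<zeta>' \<in> Q. (e \<zeta>', e \<zeta>) \<in> \<kappa>}"
    \<comment> \<open>The stages enumerated no later than \<zeta> inject into a proper initial
      segment, so there are fewer than \<kappa> of them and their mutual coherence holds
      simultaneously almost everywhere.\<close>
    have "|insert (e \<zeta>) (underS \<kappa> (e \<zeta>))| <o \<kappa>"
      using small_Un[OF small_finite[of "{e \<zeta>}"] small_underS[of "e \<zeta>"]] by simp
    then have A: "|?A| <o \<kappa>"
      by (rule small_inj_vimage[of _ e]) (use e(1) in \<open>auto simp: inj_on_def underS_def\<close>)
    have "eventually (\<lambda>\<nu>. \<forall>\<zeta>\<^sub>1\<in>?A. \<forall>\<zeta>\<^sub>2\<in>?A. C \<zeta>\<^sub>1 \<zeta>\<^sub>2 \<nu>) co_small"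
      using coh by (intro eventually_small_ball[OF A]) (simp add: C_def)
    moreover have "eventually (\<lambda>\<nu>. e \<zeta> \<in> underS \<kappa> \<nu>) co_small"
      using eventually_above e(2) \<zeta> by blast
    ultimately show ?thesis by eventually_elim (simp add: P_def \<zeta>)
  qed
  let ?ok = "\<lambda>\<nu> M. M \<subseteq> Field (f \<nu>) \<times> Field (f \<nu>) \<and> matching M \<and> |M| \<le>o g \<nu>"
  let ?new = "\<lambda>\<nu> M. \<exists>(x, y)\<in>M. \<forall>(s, Z)\<in>H \<xi> \<nu>. |Z `` {x}| \<le>o g \<nu> \<longrightarrow> (x, y) \<notin> Z"
  have ext: "\<exists>M. ?ok \<nu> M \<and> ( |X| \<le>o g \<nu> \<longrightarrow> (\<forall>\<zeta>\<in>P \<nu>. coheres (H \<zeta> \<nu>) (m \<zeta> \<nu>) M) \<and> ?new \<nu> M)"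
    if \<nu>: "\<nu> \<in> Field \<kappa>" for \<nu>
  proof (cases "|X| \<le>o g \<nu>")
    case True
    have "\<exists>M \<subseteq> Field (f \<nu>) \<times> Field (f \<nu>). matching M \<and> |M| \<le>o g \<nu> \<and>
      (\<forall>\<zeta>\<in>P \<nu>. coheres (H \<zeta> \<nu>) (m \<zeta> \<nu>) M) \<and> ?new \<nu> M"
    proof (rule coherent_extension[OF g_Cinfinite[OF \<nu>] not_Field_f_le[OF \<nu>] True P_card[OF \<nu>]])
      fix \<zeta> assume \<zeta>: "\<zeta> \<in> P \<nu>"
      show "?ok \<nu> (m \<zeta> \<nu>)" using \<zeta> m[OF _ \<nu>] unfolding P_def by blast
      show "|H \<zeta> \<nu>| \<le>o g \<nu> \<and> (\<forall>(s, Z)\<in>H \<zeta> \<nu>. s \<in> Field (f \<nu>) \<rightarrow> X)"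
        using H(1)[OF \<nu>] H(2)[of \<zeta> \<nu>] unfolding code_dom_def by fastforce
      show "coheres (H \<zeta> \<nu>) (m \<zeta> \<nu>) (m \<zeta>' \<nu>) \<or> coheres (H \<zeta>' \<nu>) (m \<zeta>' \<nu>) (m \<zeta> \<nu>)"
        if "\<zeta>' \<in> P \<nu>" for \<zeta>'
        using P_coh[OF \<zeta> that] unfolding C_def .
    qed (rule H(1)[OF \<nu>])
    then show ?thesis by blast
  next
    \<comment> \<open>On the few blocks where \<open>X\<close> is too large for the pigeonhole
      argument, the empty matching is used.\<close>
    case False
    then show ?thesis
      using finite_card_of_le[OF g_Cinfinite[OF \<nu>], of "{}"]
      by (intro exI[of _ "{}"]) (simp add: matching_def)
  qed
  then have "\<forall>\<nu>\<in>Field \<kappa>. \<exists>M. ?ok \<nu> M \<and>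
      ( |X| \<le>o g \<nu> \<longrightarrow> (\<forall>\<zeta>\<in>P \<nu>. coheres (H \<zeta> \<nu>) (m \<zeta> \<nu>) M) \<and> ?new \<nu> M)" ..
  from bchoice[OF this] obtain M where M: "\<forall>\<nu>\<in>Field \<kappa>. ?ok \<nu> (M \<nu>) \<and>
      ( |X| \<le>o g \<nu> \<longrightarrow> (\<forall>\<zeta>\<in>P \<nu>. coheres (H \<zeta> \<nu>) (m \<zeta> \<nu>) (M \<nu>)) \<and> ?new \<nu> (M \<nu>))" ..
  have "eventually (\<lambda>\<nu>. coheres (H \<zeta> \<nu>) (m \<zeta> \<nu>) (M \<nu>)) co_small" if "\<zeta> \<in> Q" for \<zeta>
    using P_ev[OF that] eventually_card_le_g[OF X] eventually_Field
    by eventually_elim (use M in blast)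
  moreover have "eventually (\<lambda>\<nu>. ?new \<nu> (M \<nu>)) co_small"
    using eventually_card_le_g[OF X] eventually_Field by eventually_elim (use M in blast)
  ultimately show ?thesis using M by blast
qed

text \<open>Recursion along \<open>r\<close>: earlier stages are at most \<kappa> in number and
  pairwise coherent by the preceding steps. The bound g(\<nu>) on the size of the matchings is
  carried through the recursion because it is what leaves fresh points at the next stage.\<close>

lemma coherent_matchings:
  fixes H :: "'d \<Rightarrow> 'k \<Rightarrow> (('k \<Rightarrow> 'b) \<times> ('k \<times> 'k) set) set"
  assumes X: "|X| <o \<kappa>" and r: "Well_order r" "\<And>\<xi>. |underS r \<xi>| \<le>o \<kappa>"
    and H: "\<And>\<xi> \<nu>. \<nu> \<in> Field \<kappa> \<Longrightarrow> |H \<xi> \<nu>| \<le>o g \<nu>" "\<And>\<xi> \<nu>. H \<xi> \<nu> \<subseteq> code_dom X \<nu>"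
  obtains m where
    "\<And>\<xi> \<nu>. \<nu> \<in> Field \<kappa> \<Longrightarrow> m \<xi> \<nu> \<subseteq> Field (f \<nu>) \<times> Field (f \<nu>) \<and> matching (m \<xi> \<nu>)"
    "\<And>\<zeta> \<xi>. \<zeta> \<in> underS r \<xi> \<Longrightarrow> eventually (\<lambda>\<nu>. coheres (H \<zeta> \<nu>) (m \<zeta> \<nu>) (m \<xi> \<nu>)) co_small"
    "\<And>\<xi>. eventually (\<lambda>\<nu>. \<exists>(x, y)\<in>m \<xi> \<nu>. \<forall>(s, Z)\<in>H \<xi> \<nu>. |Z `` {x}| \<le>o g \<nu> \<longrightarrow> (x, y) \<notin> Z) co_small"
proof -
  define ok where "ok M \<longleftrightarrow> (\<forall>\<nu>\<in>Field \<kappa>.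
    M \<nu> \<subseteq> Field (f \<nu>) \<times> Field (f \<nu>) \<and> matching (M \<nu>) \<and> |M \<nu>| \<le>o g \<nu>)" for M
  define new where "new \<xi> M \<longleftrightarrow> eventually (\<lambda>\<nu>. \<exists>(x, y)\<in>M \<nu>. \<forall>(s, Z)\<in>H \<xi> \<nu>.
    |Z `` {x}| \<le>o g \<nu> \<longrightarrow> (x, y) \<notin> Z) co_small" for \<xi> M
  define coh where "coh \<zeta> N M \<longleftrightarrow> eventually (\<lambda>\<nu>. coheres (H \<zeta> \<nu>) (N \<nu>) (M \<nu>)) co_small" for \<zeta> N M
  have "\<exists>m. \<forall>\<xi>. ok (m \<xi>) \<and> (\<forall>\<zeta>\<in>underS r \<xi>. coh \<zeta> (m \<zeta>) (m \<xi>)) \<and> new \<xi> (m \<xi>)"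
  proof (rule dependent_wf_choice[where R = "r - Id"])
    show "wf (r - Id)" using r(1) unfolding well_order_on_def by blast
    fix m :: "'d \<Rightarrow> 'k \<Rightarrow> ('k \<times> 'k) set" and m' and \<xi> M
    assume "\<And>\<zeta>. (\<zeta>, \<xi>) \<in> r - Id \<Longrightarrow> m \<zeta> = m' \<zeta>"
    then have "\<forall>\<zeta>\<in>underS r \<xi>. m \<zeta> = m' \<zeta>" unfolding underS_def by blast
    then show "(ok M \<and> (\<forall>\<zeta>\<in>underS r \<xi>. coh \<zeta> (m \<zeta>) M) \<and> new \<xi> M) \<longleftrightarrow>
      (ok M \<and> (\<forall>\<zeta>\<in>underS r \<xi>. coh \<zeta> (m' \<zeta>) M) \<and> new \<xi> M)" by simp
  next
    fix \<xi> and m :: "'d \<Rightarrow> 'k \<Rightarrow> ('k \<times> 'k) set"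
    assume IH: "\<And>\<zeta>. (\<zeta>, \<xi>) \<in> r - Id \<Longrightarrow>
      ok (m \<zeta>) \<and> (\<forall>\<zeta>'\<in>underS r \<zeta>. coh \<zeta>' (m \<zeta>') (m \<zeta>)) \<and> new \<zeta> (m \<zeta>)"
    then have ok: "ok (m \<zeta>)" and coh: "\<And>\<zeta>'. \<zeta>' \<in> underS r \<zeta> \<Longrightarrow> coh \<zeta>' (m \<zeta>') (m \<zeta>)"
      if "\<zeta> \<in> underS r \<xi>" for \<zeta>
      using that unfolding underS_def by blast+
    show "\<exists>M. ok M \<and> (\<forall>\<zeta>\<in>underS r \<xi>. coh \<zeta> (m \<zeta>) M) \<and> new \<xi> M"
      unfolding ok_def coh_def new_def
    proof (rule coherent_matchings_step[OF X r(2)[of \<xi>] H])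
      fix \<zeta> \<nu> assume "\<zeta> \<in> underS r \<xi>" "\<nu> \<in> Field \<kappa>"
      then show "m \<zeta> \<nu> \<subseteq> Field (f \<nu>) \<times> Field (f \<nu>) \<and> matching (m \<zeta> \<nu>) \<and> |m \<zeta> \<nu>| \<le>o g \<nu>"
        using ok[of \<zeta>] unfolding ok_def by blast
    next
      fix \<zeta> \<zeta>' assume \<zeta>: "\<zeta> \<in> underS r \<xi>" "\<zeta>' \<in> underS r \<xi>"
      have "\<zeta> \<in> Field r" "\<zeta>' \<in> Field r" using \<zeta> by (auto simp: underS_def intro: FieldI1)
      then have "(\<zeta>, \<zeta>') \<in> r \<or> (\<zeta>', \<zeta>) \<in> r"
        using wo_rel.TOTALS[of r] r(1) unfolding wo_rel_def by blast
      then consider "\<zeta> = \<zeta>'" | "\<zeta> \<in> underS r \<zeta>'" | "\<zeta>' \<in> underS r \<zeta>"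
        unfolding underS_def by blast
      then show "eventually (\<lambda>\<nu>. coheres (H \<zeta> \<nu>) (m \<zeta> \<nu>) (m \<zeta>' \<nu>) \<or>
        coheres (H \<zeta>' \<nu>) (m \<zeta>' \<nu>) (m \<zeta> \<nu>)) co_small"
      proof cases
        case 1
        then show ?thesis by (simp add: coheres_def)
      next
        case 2
        from coh[OF \<zeta>(2) 2] show ?thesis unfolding coh_def by (rule eventually_mono) blast
      next
        case 3
        from coh[OF \<zeta>(1) 3] show ?thesis unfolding coh_def by (rule eventually_mono) blast
      qed
    qed
  qed
  then obtain m where "\<forall>\<xi>. ok (m \<xi>) \<and> (\<forall>\<zeta>\<in>underS r \<xi>. coh \<zeta> (m \<zeta>) (m \<xi>)) \<and> new \<xi> (m \<xi>)" ..
  then show thesis using that[of m] unfolding ok_def coh_def new_def by blast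
qed

end

section \<open>Coherent involutions\<close>

definition swap :: "('a \<times> 'a) set \<Rightarrow> 'a \<Rightarrow> 'a" where
  "swap M t = (if \<exists>u. (t, u) \<in> M \<or> (u, t) \<in> M then THE u. (t, u) \<in> M \<or> (u, t) \<in> M else t)"

lemma swap_eq:
  assumes "matching M" "(t, u) \<in> M \<or> (u, t) \<in> M"
  shows "swap M t = u"
proof -
  have "v = u" if "(t, v) \<in> M \<or> (v, t) \<in> M" for v
    using assms that unfolding matching_def by fast
  then have "(THE u. (t, u) \<in> M \<or> (u, t) \<in> M) = u"
    using assms(2) by (intro the_equality)
  then show ?thesis unfolding swap_def using assms(2) by auto
qed

lemma swap_id: "t \<notin> Field M \<Longrightarrow> swap M t = t"
  unfolding swap_def by (auto intro: FieldI1 FieldI2)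

lemma swap_cases:
  assumes "matching M"
  obtains "t \<notin> Field M" "swap M t = t" | u where "(t, u) \<in> M \<or> (u, t) \<in> M" "swap M t = u"
proof (cases "t \<in> Field M")
  case True
  then obtain u where "(t, u) \<in> M \<or> (u, t) \<in> M" by (auto simp: Field_def)
  then show thesis using that(2) swap_eq[OF assms] by blast
next
  case False
  show thesis using that(1)[OF False swap_id[OF False]] .
qed

lemma swap_swap: "matching M \<Longrightarrow> swap M (swap M t) = t"
  by (rule swap_cases[of M t]) (auto intro: swap_eq)

lemma swap_closed: "matching M \<Longrightarrow> M \<subseteq> T \<times> T \<Longrightarrow> t \<in> T \<Longrightarrow> swap M t \<in> T"
  by (rule swap_cases[of M t]) auto

text \<open>A point matched by \<open>M\<close> keeps its partner in \<open>M'\<close>. A point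
  matched only by \<open>M'\<close> gets its partner through a new pair, whose two ends have the
  same value under \<open>s\<close>.\<close>

lemma swap_coheres:
  assumes "coheres H M M'" "matching M'" "(s, Z) \<in> H"
  shows "s (swap M' t) = s (swap M t)"
proof -
  have M: "M \<subseteq> M'" using assms(1) unfolding coheres_def by blast
  with assms(2) have M': "matching M" unfolding matching_def by blast
  show ?thesis
  proof (cases "t \<in> Field M")
    case True
    then obtain u where u: "(t, u) \<in> M \<or> (u, t) \<in> M" by (auto simp: Field_def)
    with M have "(t, u) \<in> M' \<or> (u, t) \<in> M'" by blast
    then have "swap M t = u" "swap M' t = u" using swap_eq[OF M' u] swap_eq[OF assms(2)] by auto
    then show ?thesis by simp
  next
    case False
    then have "swap M t = t" by (rule swap_id)
    from assms(2) show ?thesis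
    proof (cases rule: swap_cases[of M' t])
      case 1
      then show ?thesis using \<open>swap M t = t\<close> by simp
    next
      case (2 u)
      then have "(t, u) \<in> M' - M \<or> (u, t) \<in> M' - M"
        using False by (blast intro: FieldI1 FieldI2)
      moreover have "s x = s y" if "(x, y) \<in> M' - M" for x y
        using that assms(1,3) unfolding coheres_def by blast
      ultimately have "s t = s u" by metis
      then show ?thesis using \<open>swap M t = t\<close> 2(2) by simp
    qed
  qed
qed

context dagger_cardinal
begin

text \<open>There are \<kappa> blocks, each of size below \<kappa>, so disjoint copies fit into
  \<kappa>; the matchings of the individual blocks can then be assembled into one
  involution.\<close>

lemma disjoint_blocks:
  obtains w where "inj_on w (SIGMA \<nu>:Field \<kappa>. Field (f \<nu>))" "w ` (SIGMA \<nu>:Field \<kappa>. Field (f \<nu>)) \<subseteq> Field \<kappa>"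
proof -
  have "|SIGMA \<nu>:Field \<kappa>. Field (f \<nu>)| \<le>o \<kappa>"
  proof (rule card_of_Sigma_ordLeq_infinite_Field)
    show "infinite (Field \<kappa>)" using Cinfinite unfolding cinfinite_def by blast
    show "|Field \<kappa>| \<le>o \<kappa>" using card_Field ordIso_imp_ordLeq by blast
    show "\<forall>\<nu>\<in>Field \<kappa>. |Field (f \<nu>)| \<le>o \<kappa>" using small_Field_f ordLess_imp_ordLeq by blast
  qed (rule Card_order)
  then have "|SIGMA \<nu>:Field \<kappa>. Field (f \<nu>)| \<le>o |Field \<kappa>|"
    using card_Field ordIso_symmetric ordLeq_ordIso_trans by blast
  then show thesis using that unfolding card_of_ordLeq[symmetric] by blast
qed

text \<open>Blocks are placed on the first coordinate of \<kappa> \<times> \<open>bool\<close>. A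
  stage moves the first coordinate by the block matchings and always flips the second. The flip
  removes fixed points and makes \<open>A\<close> a transversal at every stage. Capturing codes of
  sequences gives stabilisation, and capturing codes of supports gives the set \<open>B\<close>, one
  point for each block where the new pair leaves the support.\<close>

lemma coherent_involutions:
  fixes \<chi> :: "'a set"
  assumes \<chi>: "|\<chi>| <o \<kappa>" "\<chi> \<noteq> {}"
  obtains r :: "('k \<Rightarrow> ('k \<Rightarrow> bool) set) rel" and q A
  where "Well_order r" "A \<subseteq> Field \<kappa>" "|A| =o \<kappa>"
    "\<And>\<xi> \<alpha>. \<alpha> \<in> Field \<kappa> \<Longrightarrow> q \<xi> \<alpha> \<in> Field \<kappa> \<and> q \<xi> (q \<xi> \<alpha>) = \<alpha> \<and> (q \<xi> \<alpha> \<in> A \<longleftrightarrow> \<alpha> \<notin> A)"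
    "\<And>\<sigma>. \<sigma> \<in> Field \<kappa> \<rightarrow> \<chi> \<Longrightarrow> \<exists>\<xi>\<in>Field r. \<forall>\<eta>. (\<xi>, \<eta>) \<in> r \<longrightarrow>
      eventually (\<lambda>\<alpha>. \<sigma> (q \<eta> \<alpha>) = \<sigma> (q \<xi> \<alpha>)) co_small"
    "\<And>Y C. |C| <o \<kappa> \<Longrightarrow> eventually (\<lambda>\<alpha>. |Y \<alpha> :: 'k set| \<le>o |C :: 'k set| ) co_small \<Longrightarrow>
      \<exists>\<xi>\<in>Field r. \<exists>B\<subseteq>A. |B| =o \<kappa> \<and> (\<forall>\<alpha>\<in>B. q \<xi> \<alpha> \<notin> Y \<alpha>) \<and>
        (\<forall>\<eta>. (\<xi>, \<eta>) \<in> r \<longrightarrow> eventually (\<lambda>\<alpha>. \<alpha> \<in> B \<longrightarrow> q \<eta> \<alpha> = q \<xi> \<alpha>) co_small)"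
proof -
  let ?T = "\<lambda>\<nu>. Field (f \<nu>)"
  let ?S = "SIGMA \<nu>:Field \<kappa>. ?T \<nu>"
  \<comment> \<open>Both halves of a block are moved by the same matching, so a sequence presents a
    pair of values at each point of the block.\<close>
  let ?X = "\<chi> \<times> \<chi>"
  have X: "|?X| <o \<kappa>" using \<chi>(1) by (rule small_Times_self)
  obtain r :: "('k \<Rightarrow> ('k \<Rightarrow> bool) set) rel" and H where r: "Well_order r" "\<And>\<xi>. |underS r \<xi>| \<le>o \<kappa>"
    and H: "\<And>\<xi> \<nu>. \<nu> \<in> Field \<kappa> \<Longrightarrow> |H \<xi> \<nu>| \<le>o g \<nu>" "\<And>\<xi> \<nu>. H \<xi> \<nu> \<subseteq> code_dom ?X \<nu>"
    and cover: "\<And>F. F \<in> (\<Pi> \<nu>\<in>Field \<kappa>. code_dom ?X \<nu>) \<Longrightarrow>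
      \<exists>\<xi>\<in>Field r. eventually (\<lambda>\<nu>. F \<nu> \<in> H \<xi> \<nu>) co_small"
  proof (rule slaloms[OF X], goal_cases)
    case (1 r H)
    show ?thesis by (rule 1(1)) (fact 1)+
  qed
  obtain m where m: "\<And>\<xi> \<nu>. \<nu> \<in> Field \<kappa> \<Longrightarrow> m \<xi> \<nu> \<subseteq> ?T \<nu> \<times> ?T \<nu> \<and> matching (m \<xi> \<nu>)"
    and coh: "\<And>\<zeta> \<xi>. \<zeta> \<in> underS r \<xi> \<Longrightarrow> eventually (\<lambda>\<nu>. coheres (H \<zeta> \<nu>) (m \<zeta> \<nu>) (m \<xi> \<nu>)) co_small"
    and new: "\<And>\<xi>. eventually (\<lambda>\<nu>. \<exists>(x, y)\<in>m \<xi> \<nu>. \<forall>(s, Z)\<in>H \<xi> \<nu>.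
      |Z `` {x}| \<le>o g \<nu> \<longrightarrow> (x, y) \<notin> Z) co_small"
  proof (rule coherent_matchings[OF X r, of H], goal_cases)
    case (3 m)
    show ?thesis by (rule 3(1)[of m]) (fact 3)+
  qed (use H in blast)+
  have coh_le: "eventually (\<lambda>\<nu>. coheres (H \<zeta> \<nu>) (m \<zeta> \<nu>) (m \<xi> \<nu>)) co_small" if "(\<zeta>, \<xi>) \<in> r" for \<zeta> \<xi>
    using that coh[of \<zeta> \<xi>] by (cases "\<zeta> = \<xi>") (auto simp: coheres_def underS_def)
  obtain p :: "'k \<times> bool \<Rightarrow> 'k" where p: "bij_betw p (Field \<kappa> \<times> UNIV) (Field \<kappa>)"
    by (rule bij_Times_bool)
  obtain w where w: "inj_on w ?S" "w ` ?S \<subseteq> Field \<kappa>"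
    by (rule disjoint_blocks)
  have w_inj: "\<nu> = \<nu>' \<and> t = t'" if "w (\<nu>, t) = w (\<nu>', t')" "\<nu> \<in> Field \<kappa>" "t \<in> ?T \<nu>" "\<nu>' \<in> Field \<kappa>" "t' \<in> ?T \<nu>'" for \<nu> t \<nu>' t'
    using inj_onD[OF w(1) that(1)] that by auto
  have w_in: "w (\<nu>, t) \<in> Field \<kappa>" if "\<nu> \<in> Field \<kappa>" "t \<in> ?T \<nu>" for \<nu> t
    using w(2) that by auto
  have p_inj: "\<beta> = \<beta>' \<and> c = c'" if "p (\<beta>, c) = p (\<beta>', c')" "\<beta> \<in> Field \<kappa>" "\<beta>' \<in> Field \<kappa>" for \<beta> \<beta>' c c'
    using inj_onD[OF bij_betw_imp_inj_on[OF p] that(1)] that by auto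
  have p_in: "p (\<beta>, c) \<in> Field \<kappa>" if "\<beta> \<in> Field \<kappa>" for \<beta> c
    using bij_betw_imp_surj_on[OF p] that by auto
  have p_ex: "\<exists>\<beta>\<in>Field \<kappa>. \<exists>c. \<alpha> = p (\<beta>, c)" if "\<alpha> \<in> Field \<kappa>" for \<alpha>
  proof -
    have "\<alpha> \<in> p ` (Field \<kappa> \<times> UNIV)" using bij_betw_imp_surj_on[OF p] that by simp
    then show ?thesis by auto
  qed
  define pt where "pt \<nu> t c = p (w (\<nu>, t), c)" for \<nu> t c
  have pt_in: "pt \<nu> t c \<in> Field \<kappa>" if "\<nu> \<in> Field \<kappa>" "t \<in> ?T \<nu>" for \<nu> t c
    unfolding pt_def using that by (intro p_in w_in)
  have pt_inj: "\<nu> = \<nu>' \<and> t = t' \<and> c = c'"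
    if "pt \<nu> t c = pt \<nu>' t' c'" "\<nu> \<in> Field \<kappa>" "t \<in> ?T \<nu>" "\<nu>' \<in> Field \<kappa>" "t' \<in> ?T \<nu>'" for \<nu> t c \<nu>' t' c'
    using p_inj[OF that(1)[unfolded pt_def]] w_in w_inj[of \<nu> t \<nu>' t'] that by blast
  \<comment> \<open>Blocks are small, so a small set of exceptional blocks contributes only a small
    set of exceptional points.\<close>
  have block_ev: "eventually (\<lambda>\<alpha>. \<forall>\<nu>\<in>Field \<kappa>. \<forall>t\<in>?T \<nu>. \<forall>c. \<alpha> = pt \<nu> t c \<longrightarrow> R \<nu>) co_small"
    if "eventually R co_small" for R
  proof -
    have "|\<Union>\<nu>\<in>{\<nu> \<in> Field \<kappa>. \<not> R \<nu>}. (\<lambda>t. pt \<nu> t True) ` ?T \<nu> \<union> (\<lambda>t. pt \<nu> t False) ` ?T \<nu>| <o \<kappa>"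
      by (rule small_UN[OF that[unfolded eventually_co_small]])
        (auto intro!: small_Un small_image small_Field_f)
    then show ?thesis
      unfolding eventually_co_small
    proof (rule card_of_subset_less[rotated], intro subsetI)
      fix \<alpha>
      assume "\<alpha> \<in> {\<alpha> \<in> Field \<kappa>. \<not> (\<forall>\<nu>\<in>Field \<kappa>. \<forall>t\<in>?T \<nu>. \<forall>c. \<alpha> = pt \<nu> t c \<longrightarrow> R \<nu>)}"
      then obtain \<nu> t c where "\<nu> \<in> Field \<kappa>" "\<not> R \<nu>" "t \<in> ?T \<nu>" "\<alpha> = pt \<nu> t c" by blast
      then show "\<alpha> \<in> (\<Union>\<nu>\<in>{\<nu> \<in> Field \<kappa>. \<not> R \<nu>}. (\<lambda>t. pt \<nu> t True) ` ?T \<nu> \<union> (\<lambda>t. pt \<nu> t False) ` ?T \<nu>)"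
        by (cases c) auto
    qed
  qed
  \<comment> \<open>In the other direction, a small set of exceptional points meets only few blocks,
    since blocks are disjoint.\<close>
  have ev_block: "eventually (\<lambda>\<nu>. \<forall>t\<in>?T \<nu>. R (pt \<nu> t c)) co_small" if "eventually R co_small" for R c
  proof -
    define b where "b \<alpha> = (SOME \<nu>. \<nu> \<in> Field \<kappa> \<and> (\<exists>t\<in>?T \<nu>. \<alpha> = pt \<nu> t c))" for \<alpha>
    have b: "b (pt \<nu> t c) = \<nu>" if "\<nu> \<in> Field \<kappa>" "t \<in> ?T \<nu>" for \<nu> t
      unfolding b_def using that by (intro some_equality) (auto dest: pt_inj)
    have "|b ` {\<alpha> \<in> Field \<kappa>. \<not> R \<alpha>}| <o \<kappa>"
      using that unfolding eventually_co_small by (rule small_image)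
    then show ?thesis
      unfolding eventually_co_small
    proof (rule card_of_subset_less[rotated], intro subsetI)
      fix \<nu> assume "\<nu> \<in> {\<nu> \<in> Field \<kappa>. \<not> (\<forall>t\<in>?T \<nu>. R (pt \<nu> t c))}"
      then obtain t where "\<nu> \<in> Field \<kappa>" "t \<in> ?T \<nu>" "\<not> R (pt \<nu> t c)" by blast
      then show "\<nu> \<in> b ` {\<alpha> \<in> Field \<kappa>. \<not> R \<alpha>}"
        using b[of \<nu> t] pt_in[of \<nu> t c] by (intro image_eqI[of _ _ "pt \<nu> t c"]) auto
    qed
  qed
  define \<theta> where "\<theta> \<xi> \<beta> = (if \<beta> \<in> w ` ?S
    then case inv_into ?S w \<beta> of (\<nu>, t) \<Rightarrow> w (\<nu>, swap (m \<xi> \<nu>) t) else \<beta>)" for \<xi> \<beta>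
  have \<theta>_w: "\<theta> \<xi> (w (\<nu>, t)) = w (\<nu>, swap (m \<xi> \<nu>) t)" if "\<nu> \<in> Field \<kappa>" "t \<in> ?T \<nu>" for \<xi> \<nu> t
  proof -
    have "(\<nu>, t) \<in> ?S" using that by auto
    then show ?thesis unfolding \<theta>_def using inv_into_f_f[OF w(1), of "(\<nu>, t)"] by auto
  qed
  have swap_in: "swap (m \<xi> \<nu>) t \<in> ?T \<nu>" if "\<nu> \<in> Field \<kappa>" "t \<in> ?T \<nu>" for \<xi> \<nu> t
    using m[OF that(1)] that(2) by (blast intro: swap_closed)
  have \<theta>_inv: "\<theta> \<xi> \<beta> \<in> Field \<kappa> \<and> \<theta> \<xi> (\<theta> \<xi> \<beta>) = \<beta>" if "\<beta> \<in> Field \<kappa>" for \<xi> \<beta>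
  proof (cases "\<beta> \<in> w ` ?S")
    case True
    then obtain \<nu> t where \<beta>: "\<nu> \<in> Field \<kappa>" "t \<in> ?T \<nu>" "\<beta> = w (\<nu>, t)" by auto
    then show ?thesis using swap_in[of \<nu> t \<xi>] m[of \<nu> \<xi>] by (simp add: \<theta>_w w_in swap_swap)
  next
    case False
    then show ?thesis using that by (simp add: \<theta>_def)
  qed
  define q where "q \<xi> \<alpha> = (case inv_into (Field \<kappa> \<times> UNIV) p \<alpha> of (\<beta>, c) \<Rightarrow> p (\<theta> \<xi> \<beta>, \<not> c))" for \<xi> \<alpha>
  have q_p: "q \<xi> (p (\<beta>, c)) = p (\<theta> \<xi> \<beta>, \<not> c)" if "\<beta> \<in> Field \<kappa>" for \<xi> \<beta> c
    unfolding q_def using inv_into_f_f[OF bij_betw_imp_inj_on[OF p], of "(\<beta>, c)"] that by auto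
  have q_pt: "q \<xi> (pt \<nu> t c) = pt \<nu> (swap (m \<xi> \<nu>) t) (\<not> c)" if "\<nu> \<in> Field \<kappa>" "t \<in> ?T \<nu>" for \<xi> \<nu> t c
    using that by (simp add: pt_def q_p w_in \<theta>_w)
  have q_other: "q \<xi> \<alpha> = q \<eta> \<alpha>"
    if \<alpha>: "\<alpha> \<in> Field \<kappa>" "\<not> (\<exists>\<nu>\<in>Field \<kappa>. \<exists>t\<in>?T \<nu>. \<exists>c. \<alpha> = pt \<nu> t c)" for \<xi> \<eta> \<alpha>
  proof -
    obtain \<beta> c where \<beta>: "\<beta> \<in> Field \<kappa>" "\<alpha> = p (\<beta>, c)" using p_ex[OF \<alpha>(1)] by blast
    then have "\<beta> \<notin> w ` ?S" using \<alpha>(2) unfolding pt_def by blast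
    then show ?thesis using \<beta> by (simp add: q_p \<theta>_def)
  qed
  define A where "A = p ` (Field \<kappa> \<times> {True})"
  have A: "A \<subseteq> Field \<kappa>" unfolding A_def using p_in by auto
  show thesis
  proof
    show "Well_order r" by fact
    show "A \<subseteq> Field \<kappa>" by fact
    have "\<not> |A| <o \<kappa>"
    proof
      assume "|A| <o \<kappa>"
      then have "|Field \<kappa>| <o \<kappa>"
        by (rule small_inj_vimage[of _ "\<lambda>\<beta>. p (\<beta>, True)"]) (auto simp: A_def inj_on_def dest: p_inj)
      then show False using card_Field not_ordLess_ordIso by blast
    qed
    then show "|A| =o \<kappa>" using A by (rule card_of_subset_Field[rotated])
    have A_iff: "p (\<beta>, c) \<in> A \<longleftrightarrow> c" if "\<beta> \<in> Field \<kappa>" for \<beta> c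
      using that unfolding A_def by (auto dest: p_inj)
    show "q \<xi> \<alpha> \<in> Field \<kappa> \<and> q \<xi> (q \<xi> \<alpha>) = \<alpha> \<and> (q \<xi> \<alpha> \<in> A \<longleftrightarrow> \<alpha> \<notin> A)" if \<alpha>: "\<alpha> \<in> Field \<kappa>" for \<xi> \<alpha>
    proof -
      obtain \<beta> c where \<beta>: "\<beta> \<in> Field \<kappa>" "\<alpha> = p (\<beta>, c)" using p_ex[OF \<alpha>] by blast
      then show ?thesis using \<theta>_inv[of \<beta> \<xi>] by (simp add: q_p p_in A_iff)
    qed
  next
    fix \<sigma> assume \<sigma>: "\<sigma> \<in> Field \<kappa> \<rightarrow> \<chi>"
    \<comment> \<open>The code of \<sigma> on a block lists its values on both halves; the relation
      component is filled with the empty set.\<close>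
    let ?s = "\<lambda>\<nu>. \<lambda>t\<in>?T \<nu>. (\<sigma> (pt \<nu> t True), \<sigma> (pt \<nu> t False))"
    have "(?s \<nu>, {}) \<in> code_dom ?X \<nu>" if "\<nu> \<in> Field \<kappa>" for \<nu>
      unfolding code_dom_def using \<sigma> pt_in[OF that] by auto
    then obtain \<xi> where \<xi>: "\<xi> \<in> Field r" "eventually (\<lambda>\<nu>. (?s \<nu>, {}) \<in> H \<xi> \<nu>) co_small"
      using cover[of "\<lambda>\<nu>. (?s \<nu>, {})"] by auto
    have "eventually (\<lambda>\<alpha>. \<sigma> (q \<eta> \<alpha>) = \<sigma> (q \<xi> \<alpha>)) co_small" if "(\<xi>, \<eta>) \<in> r" for \<eta>
      using block_ev[OF coh_le[OF that]] block_ev[OF \<xi>(2)] eventually_Field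
    proof eventually_elim
      case (elim \<alpha>)
      show ?case
      proof (cases "\<exists>\<nu>\<in>Field \<kappa>. \<exists>t\<in>?T \<nu>. \<exists>c. \<alpha> = pt \<nu> t c")
        case True
        then obtain \<nu> t c where \<nu>: "\<nu> \<in> Field \<kappa>" "t \<in> ?T \<nu>" "\<alpha> = pt \<nu> t c" by blast
        then have "coheres (H \<xi> \<nu>) (m \<xi> \<nu>) (m \<eta> \<nu>)" "(?s \<nu>, {}) \<in> H \<xi> \<nu>"
          using elim(1,2) by blast+
        from swap_coheres[OF this(1) _ this(2), of t] m[OF \<nu>(1)]
        have "?s \<nu> (swap (m \<eta> \<nu>) t) = ?s \<nu> (swap (m \<xi> \<nu>) t)" by blast
        then show ?thesis using \<nu> swap_in[OF \<nu>(1,2)] by (cases c) (simp_all add: q_pt)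
      next
        case False
        show ?thesis using q_other[OF elim(3) False, of \<eta> \<xi>] by simp
      qed
    qed
    with \<xi>(1) show "\<exists>\<xi>\<in>Field r. \<forall>\<eta>. (\<xi>, \<eta>) \<in> r \<longrightarrow>
      eventually (\<lambda>\<alpha>. \<sigma> (q \<eta> \<alpha>) = \<sigma> (q \<xi> \<alpha>)) co_small" by blast
  next
    fix Y :: "'k \<Rightarrow> 'k set" and C :: "'k set"
    assume C: "|C| <o \<kappa>" "eventually (\<lambda>\<alpha>. |Y \<alpha>| \<le>o |C| ) co_small"
    \<comment> \<open>A point in the \<open>True\<close> half can only be matched to the
      \<open>False\<close> half of its own block, so this relation records exactly the part of the
      support that a partner could hit.\<close>
    define Z where "Z \<nu> = {(t, u) \<in> ?T \<nu> \<times> ?T \<nu>. pt \<nu> u False \<in> Y (pt \<nu> t True)}" for \<nu>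
    obtain a where a: "a \<in> \<chi>" using \<chi>(2) by blast
    \<comment> \<open>A constant sequence fills the first component of the code.\<close>
    let ?s = "\<lambda>\<nu>. \<lambda>t\<in>?T \<nu>. (a, a)"
    have "(?s \<nu>, Z \<nu>) \<in> code_dom ?X \<nu>" for \<nu>
      unfolding code_dom_def Z_def using a by auto
    then obtain \<xi> where \<xi>: "\<xi> \<in> Field r" "eventually (\<lambda>\<nu>. (?s \<nu>, Z \<nu>) \<in> H \<xi> \<nu>) co_small"
      using cover[of "\<lambda>\<nu>. (?s \<nu>, Z \<nu>)"] by auto
    let ?R = "\<lambda>\<nu>. \<exists>(x, y)\<in>m \<xi> \<nu>. pt \<nu> y False \<notin> Y (pt \<nu> x True)"
    have "eventually ?R co_small"
      using \<xi>(2) new[of \<xi>] ev_block[OF C(2), of True] eventually_card_le_g[OF C(1)] eventually_Field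
    proof eventually_elim
      case (elim \<nu>)
      then obtain x y where xy: "(x, y) \<in> m \<xi> \<nu>" "|Z \<nu> `` {x}| \<le>o g \<nu> \<longrightarrow> (x, y) \<notin> Z \<nu>"
        by fast
      with m[OF elim(5)] have T: "x \<in> ?T \<nu>" "y \<in> ?T \<nu>" by blast+
      \<comment> \<open>The section of \<open>Z \<nu>\<close> at \<open>x\<close> is bounded by the
        support, hence by g(\<nu>) on almost all blocks; this is the condition under which the new
        pair avoids \<open>Z \<nu>\<close>.\<close>
      have "|Z \<nu> `` {x}| \<le>o |Y (pt \<nu> x True)|"
        by (rule card_of_ordLeqI[of "\<lambda>u. pt \<nu> u False"])
          (use elim(5) in \<open>auto simp: Z_def inj_on_def dest: pt_inj\<close>)
      also have "|Y (pt \<nu> x True)| \<le>o |C|" using elim(3) T(1) by blast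
      also have "|C| \<le>o g \<nu>" by (rule elim(4))
      finally have "(x, y) \<notin> Z \<nu>" using xy(2) by blast
      then show ?case using xy(1) T unfolding Z_def by blast
    qed
    then have N: "\<not> |{\<nu> \<in> Field \<kappa>. ?R \<nu>}| <o \<kappa>"
      unfolding eventually_co_small by (rule small_complement)
    have "\<forall>\<nu>\<in>{\<nu> \<in> Field \<kappa>. ?R \<nu>}. \<exists>xy. xy \<in> m \<xi> \<nu> \<and> pt \<nu> (snd xy) False \<notin> Y (pt \<nu> (fst xy) True)"
      by fastforce
    from bchoice[OF this] obtain xy where xy: "\<forall>\<nu>\<in>{\<nu> \<in> Field \<kappa>. ?R \<nu>}.
      xy \<nu> \<in> m \<xi> \<nu> \<and> pt \<nu> (snd (xy \<nu>)) False \<notin> Y (pt \<nu> (fst (xy \<nu>)) True)" ..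
    define x y where "x \<nu> = fst (xy \<nu>)" and "y \<nu> = snd (xy \<nu>)" for \<nu>
    have xy_m: "(x \<nu>, y \<nu>) \<in> m \<xi> \<nu>" and xy_Y: "pt \<nu> (y \<nu>) False \<notin> Y (pt \<nu> (x \<nu>) True)"
      if "\<nu> \<in> {\<nu> \<in> Field \<kappa>. ?R \<nu>}" for \<nu>
      using bspec[OF xy that] by (auto simp: x_def y_def)
    have xT: "x \<nu> \<in> ?T \<nu>" if "\<nu> \<in> {\<nu> \<in> Field \<kappa>. ?R \<nu>}" for \<nu>
      using xy_m[OF that] m[of \<nu> \<xi>] that by blast
    have q_x: "q \<eta> (pt \<nu> (x \<nu>) True) = pt \<nu> (y \<nu>) False"
      if "\<nu> \<in> {\<nu> \<in> Field \<kappa>. ?R \<nu>}" "m \<xi> \<nu> \<subseteq> m \<eta> \<nu>" for \<nu> \<eta>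
    proof -
      have "(x \<nu>, y \<nu>) \<in> m \<eta> \<nu>" using xy_m[OF that(1)] that(2) by blast
      then have "swap (m \<eta> \<nu>) (x \<nu>) = y \<nu>" using m[of \<nu> \<eta>] that(1) by (intro swap_eq) auto
      then show ?thesis using q_pt[OF _ xT[OF that(1)], of \<eta> True] that(1) by simp
    qed
    define B where "B = (\<lambda>\<nu>. pt \<nu> (x \<nu>) True) ` {\<nu> \<in> Field \<kappa>. ?R \<nu>}"
    have BA: "B \<subseteq> A"
    proof
      fix \<alpha> assume "\<alpha> \<in> B"
      then obtain \<nu> where \<nu>: "\<nu> \<in> {\<nu> \<in> Field \<kappa>. ?R \<nu>}" "\<alpha> = pt \<nu> (x \<nu>) True"
        unfolding B_def by blast
      then have "w (\<nu>, x \<nu>) \<in> Field \<kappa>" using w_in[OF _ xT[OF \<nu>(1)]] by simp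
      then show "\<alpha> \<in> A" using \<nu>(2) unfolding A_def pt_def by blast
    qed
    have "\<not> |B| <o \<kappa>"
    proof
      assume "|B| <o \<kappa>"
      then have "|{\<nu> \<in> Field \<kappa>. ?R \<nu>}| <o \<kappa>"
      proof (rule small_inj_vimage)
        show "inj_on (\<lambda>\<nu>. pt \<nu> (x \<nu>) True) {\<nu> \<in> Field \<kappa>. ?R \<nu>}"
        proof (rule inj_onI)
          fix \<nu> \<nu>' assume "\<nu> \<in> {\<nu> \<in> Field \<kappa>. ?R \<nu>}" "\<nu>' \<in> {\<nu> \<in> Field \<kappa>. ?R \<nu>}"
            and "pt \<nu> (x \<nu>) True = pt \<nu>' (x \<nu>') True"
          then show "\<nu> = \<nu>'" using pt_inj[of \<nu> "x \<nu>" True \<nu>' "x \<nu>'" True] xT by blast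
        qed
      qed (simp add: B_def)
      then show False using N by blast
    qed
    then have "|B| =o \<kappa>"
      using BA A by (intro card_of_subset_Field) auto
    moreover have "\<forall>\<alpha>\<in>B. q \<xi> \<alpha> \<notin> Y \<alpha>"
      using q_x[of _ \<xi>] xy_Y unfolding B_def by auto
    \<comment> \<open>Later matchings contain the pairs of stage \<xi> on almost all blocks, so the
      chosen points keep their partners.\<close>
    moreover have "eventually (\<lambda>\<alpha>. \<alpha> \<in> B \<longrightarrow> q \<eta> \<alpha> = q \<xi> \<alpha>) co_small" if "(\<xi>, \<eta>) \<in> r" for \<eta>
      using block_ev[OF coh_le[OF that]]
    proof eventually_elim
      case (elim \<alpha>)
      show ?case
      proof
        assume "\<alpha> \<in> B"
        then obtain \<nu> where \<nu>: "\<nu> \<in> {\<nu> \<in> Field \<kappa>. ?R \<nu>}" "\<alpha> = pt \<nu> (x \<nu>) True"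
          unfolding B_def by blast
        then have "coheres (H \<xi> \<nu>) (m \<xi> \<nu>) (m \<eta> \<nu>)" using elim xT by blast
        then have "m \<xi> \<nu> \<subseteq> m \<eta> \<nu>" unfolding coheres_def by blast
        then show "q \<eta> \<alpha> = q \<xi> \<alpha>" using q_x[OF \<nu>(1)] \<nu>(2) by simp
      qed
    qed
    ultimately show "\<exists>\<xi>\<in>Field r. \<exists>B\<subseteq>A. |B| =o \<kappa> \<and> (\<forall>\<alpha>\<in>B. q \<xi> \<alpha> \<notin> Y \<alpha>) \<and>
        (\<forall>\<eta>. (\<xi>, \<eta>) \<in> r \<longrightarrow> eventually (\<lambda>\<alpha>. \<alpha> \<in> B \<longrightarrow> q \<eta> \<alpha> = q \<xi> \<alpha>) co_small)"
      using \<xi>(1) BA by blast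
  qed
qed

end

section \<open>Reduced powers\<close>

lemma universe_power: "universe (ualg_power U Z) = (Z \<rightarrow>\<^sub>E universe U)"
  by (simp add: ualg_power_def)

lemma args_power_coord:
  "\<sigma>s \<in> args (ualg_power U Z) s \<Longrightarrow> z \<in> Z \<Longrightarrow> map (\<lambda>\<sigma>. \<sigma> z) \<sigma>s \<in> args U s"
  unfolding args_def ualg_power_def by (auto simp: subset_iff)

lemma interp_power_in_universe:
  assumes "universal_algebra U" "s \<in> symbols U" "\<sigma>s \<in> args (ualg_power U Z) s"
  shows "interp (ualg_power U Z) s \<sigma>s \<in> universe (ualg_power U Z)"
  using assms args_power_coord[OF assms(3)]
  by (auto simp: universal_algebra_def ualg_power_def)

lemma coordinatewise_hom:
  assumes h: "\<And>\<sigma> z. \<sigma> \<in> universe (ualg_power U Z) \<Longrightarrow> z \<in> Z \<Longrightarrow> h z \<sigma> \<in> universe U"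
    and h_interp: "\<And>s \<sigma>s z. s \<in> symbols U \<Longrightarrow> \<sigma>s \<in> args (ualg_power U Z) s \<Longrightarrow> z \<in> Z \<Longrightarrow>
      h z (interp (ualg_power U Z) s \<sigma>s) = interp U s (map (h z) \<sigma>s)"
  shows "(\<lambda>\<sigma>. \<lambda>z\<in>Z. h z \<sigma>) \<in> ualg_hom (ualg_power U Z) (ualg_power U Z)"
  unfolding ualg_hom_def
proof (intro CollectI conjI ballI refl Pi_I)
  show "(\<lambda>z\<in>Z. h z \<sigma>) \<in> universe (ualg_power U Z)" if "\<sigma> \<in> universe (ualg_power U Z)" for \<sigma>
    using h[OF that] by (auto simp: universe_power)
  fix s \<sigma>s assume s: "s \<in> symbols (ualg_power U Z)" "\<sigma>s \<in> args (ualg_power U Z) s"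
  then have "s \<in> symbols U" by (simp add: ualg_power_def)
  from h_interp[OF this s(2)]
  show "(\<lambda>z\<in>Z. h z (interp (ualg_power U Z) s \<sigma>s)) = interp (ualg_power U Z) s (map (\<lambda>\<sigma>. \<lambda>z\<in>Z. h z \<sigma>) \<sigma>s)"
    by (auto simp: ualg_power_def comp_def intro!: restrict_ext)
qed

lemma reindex_hom:
  assumes "i \<in> Z \<rightarrow> Z"
  shows "(\<lambda>\<sigma>. \<lambda>z\<in>Z. \<sigma> (i z)) \<in> ualg_hom (ualg_power U Z) (ualg_power U Z)"
  by (rule coordinatewise_hom) (use assms in \<open>auto simp: ualg_power_def comp_def\<close>)

lemma average_in: "average U Av \<Longrightarrow> x \<in> universe U \<Longrightarrow> y \<in> universe U \<Longrightarrow> Av (x, y) \<in> universe U"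
  unfolding average_def ualg_hom_def ualg_prod_def by auto

lemma average_interp:
  assumes "average U Av" "s \<in> symbols U" "xs \<in> args U s" "ys \<in> args U s"
  shows "Av (interp U s xs, interp U s ys) = interp U s (map Av (zip xs ys))"
proof -
  have len: "length xs = length ys" using assms(3,4) by (simp add: args_def)
  have "zip xs ys \<in> args (ualg_prod U U) s"
    using assms(3,4) by (auto simp: args_def ualg_prod_def dest: set_zip_leftD set_zip_rightD)
  then have "Av (interp (ualg_prod U U) s (zip xs ys)) = interp U s (map Av (zip xs ys))"
    using assms(1,2) unfolding average_def ualg_hom_def by (auto simp: ualg_prod_def)
  then show ?thesis using len by (simp add: ualg_prod_def)
qed

text \<open>Because \<open>Av\<close> is itself a homomorphism, averaging two coordinates commutes
  with the operations.\<close>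

lemma average_hom:
  assumes "average U Av" "q \<in> Z \<rightarrow> Z"
  shows "(\<lambda>\<sigma>. \<lambda>z\<in>Z. Av (\<sigma> z, \<sigma> (q z))) \<in> ualg_hom (ualg_power U Z) (ualg_power U Z)"
proof (rule coordinatewise_hom)
  fix \<sigma> z assume "\<sigma> \<in> universe (ualg_power U Z)" "z \<in> Z"
  then show "Av (\<sigma> z, \<sigma> (q z)) \<in> universe U"
    using assms by (intro average_in[OF assms(1)]) (auto simp: universe_power)
next
  fix s \<sigma>s z assume s: "s \<in> symbols U" "\<sigma>s \<in> args (ualg_power U Z) s" and z: "z \<in> Z"
  have q: "q z \<in> Z" using assms(2) z by blast
  have "Av (interp U s (map (\<lambda>\<sigma>. \<sigma> z) \<sigma>s), interp U s (map (\<lambda>\<sigma>. \<sigma> (q z)) \<sigma>s)) =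
    interp U s (map Av (zip (map (\<lambda>\<sigma>. \<sigma> z) \<sigma>s) (map (\<lambda>\<sigma>. \<sigma> (q z)) \<sigma>s)))"
    by (rule average_interp[OF assms(1) s(1) args_power_coord[OF s(2) z] args_power_coord[OF s(2) q]])
  also have "zip (map (\<lambda>\<sigma>. \<sigma> z) \<sigma>s) (map (\<lambda>\<sigma>. \<sigma> (q z)) \<sigma>s) = map (\<lambda>\<sigma>. (\<sigma> z, \<sigma> (q z))) \<sigma>s"
    by (simp add: zip_map_map zip_same_conv_map)
  finally show "Av (interp (ualg_power U Z) s \<sigma>s z, interp (ualg_power U Z) s \<sigma>s (q z)) =
      interp U s (map (\<lambda>\<sigma>. Av (\<sigma> z, \<sigma> (q z))) \<sigma>s)"
    using z q by (simp add: ualg_power_def comp_def)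
qed

lemma ualg_hom_in: "h \<in> ualg_hom A B \<Longrightarrow> x \<in> universe A \<Longrightarrow> h x \<in> universe B"
  unfolding ualg_hom_def by blast

lemma symbols_reduced_power [simp]: "symbols (reduced_power U k) = symbols U"
  and arity_reduced_power [simp]: "arity (reduced_power U k) = arity U"
  and symbols_power [simp]: "symbols (ualg_power U Z) = symbols U"
  and arity_power [simp]: "arity (ualg_power U Z) = arity U"
  by (simp_all add: reduced_power_def ualg_quotient_def ualg_power_def)

lemma universe_reduced_power: "universe (reduced_power U k) = quot_map U k ` universe (ualg_power U (Field k))"
  by (auto simp: reduced_power_def ualg_quotient_def quotient_def quot_map_def)

section \<open>The quotient modulo small sets\<close>

context regular_cardinal
begin

lemma small_diff_iff:
  "(\<sigma>, \<tau>) \<in> small_diff U \<kappa> \<longleftrightarrow>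
    \<sigma> \<in> universe (ualg_power U (Field \<kappa>)) \<and> \<tau> \<in> universe (ualg_power U (Field \<kappa>)) \<and>
    eventually (\<lambda>\<alpha>. \<sigma> \<alpha> = \<tau> \<alpha>) co_small"
  unfolding small_diff_def eventually_co_small by auto

lemma equiv_small_diff: "equiv (universe (ualg_power U (Field \<kappa>))) (small_diff U \<kappa>)"
proof (rule equivI)
  show "small_diff U \<kappa> \<subseteq> universe (ualg_power U (Field \<kappa>)) \<times> universe (ualg_power U (Field \<kappa>))"
    by (auto simp: small_diff_iff)
  show "refl_on (universe (ualg_power U (Field \<kappa>))) (small_diff U \<kappa>)"
    by (auto simp: refl_on_def small_diff_iff)
  show "sym (small_diff U \<kappa>)"
    by (auto simp: sym_def small_diff_iff elim: eventually_mono)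
  show "trans (small_diff U \<kappa>)"
    by (rule transI) (auto simp: small_diff_iff elim: eventually_elim2)
qed

lemma quot_map_eq_iff:
  assumes "\<sigma> \<in> universe (ualg_power U (Field \<kappa>))" "\<tau> \<in> universe (ualg_power U (Field \<kappa>))"
  shows "quot_map U \<kappa> \<sigma> = quot_map U \<kappa> \<tau> \<longleftrightarrow> eventually (\<lambda>\<alpha>. \<sigma> \<alpha> = \<tau> \<alpha>) co_small"
  unfolding quot_map_def eq_equiv_class_iff[OF equiv_small_diff assms]
  using assms by (simp add: small_diff_iff)

lemma interp_power_cong:
  assumes U: "universal_algebra U" and s: "s \<in> symbols U" and \<sigma>s: "\<sigma>s \<in> args (ualg_power U (Field \<kappa>)) s"
    and \<tau>s: "list_all2 (\<lambda>\<tau> \<sigma>. (\<sigma>, \<tau>) \<in> small_diff U \<kappa>) \<tau>s \<sigma>s"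
  shows "(interp (ualg_power U (Field \<kappa>)) s \<sigma>s, interp (ualg_power U (Field \<kappa>)) s \<tau>s) \<in> small_diff U \<kappa>"
proof -
  have "set \<tau>s \<subseteq> universe (ualg_power U (Field \<kappa>))"
    using \<tau>s by induction (auto simp: small_diff_iff)
  moreover have "length \<tau>s = length \<sigma>s" using \<tau>s by (rule list_all2_lengthD)
  ultimately have "\<tau>s \<in> args (ualg_power U (Field \<kappa>)) s" using \<sigma>s by (simp add: args_def)
  moreover have "eventually (\<lambda>\<alpha>. map (\<lambda>\<sigma>. \<sigma> \<alpha>) \<sigma>s = map (\<lambda>\<tau>. \<tau> \<alpha>) \<tau>s) co_small"
    using \<tau>s by induction (auto simp: small_diff_iff elim: eventually_elim2)
  then have "eventually (\<lambda>\<alpha>. interp (ualg_power U (Field \<kappa>)) s \<sigma>s \<alpha> =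
      interp (ualg_power U (Field \<kappa>)) s \<tau>s \<alpha>) co_small"
    by (rule eventually_mono) (simp add: ualg_power_def restrict_def)
  ultimately show ?thesis
    using U s \<sigma>s by (simp add: small_diff_iff interp_power_in_universe)
qed

text \<open>The quotient operation collects the values at all representatives; by the congruence
  property these values lie in a single class.\<close>

lemma interp_reduced_power:
  assumes U: "universal_algebra U" and s: "s \<in> symbols U" and \<sigma>s: "\<sigma>s \<in> args (ualg_power U (Field \<kappa>)) s"
  shows "interp (reduced_power U \<kappa>) s (map (quot_map U \<kappa>) \<sigma>s) =
    quot_map U \<kappa> (interp (ualg_power U (Field \<kappa>)) s \<sigma>s)"
proof -
  let ?P = "ualg_power U (Field \<kappa>)" and ?R = "small_diff U \<kappa>"
  let ?S = "{interp ?P s xs | xs. list_all2 (\<in>) xs (map (quot_map U \<kappa>) \<sigma>s)}"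
  have "list_all2 (\<in>) \<sigma>s (map (quot_map U \<kappa>) \<sigma>s)"
    using \<sigma>s equiv_class_self[OF equiv_small_diff]
    by (auto simp: list_all2_map2 list_all2_same args_def quot_map_def)
  then have "interp ?P s \<sigma>s \<in> ?S" by blast
  moreover have "?R `` {\<rho>} = ?R `` {interp ?P s \<sigma>s}" if \<rho>: "\<rho> \<in> ?S" for \<rho>
  proof -
    obtain xs where xs: "\<rho> = interp ?P s xs" "list_all2 (\<in>) xs (map (quot_map U \<kappa>) \<sigma>s)"
      using \<rho> by blast
    have "list_all2 (\<lambda>\<tau> \<sigma>. (\<sigma>, \<tau>) \<in> ?R) xs \<sigma>s"
      using xs(2) by (simp add: list_all2_map2 quot_map_def)
    from interp_power_cong[OF U s \<sigma>s this] show ?thesis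
      unfolding xs(1) using equiv_class_eq[OF equiv_small_diff] by metis
  qed
  ultimately have "?R `` ?S = ?R `` {interp ?P s \<sigma>s}" by blast
  then show ?thesis by (simp add: reduced_power_def ualg_quotient_def quot_map_def)
qed

lemma args_reduced_power:
  assumes "Xs \<in> args (reduced_power U \<kappa>) s"
  obtains \<sigma>s where "\<sigma>s \<in> args (ualg_power U (Field \<kappa>)) s" "Xs = map (quot_map U \<kappa>) \<sigma>s"
proof -
  have "Xs \<in> lists (quot_map U \<kappa> ` universe (ualg_power U (Field \<kappa>)))"
    using assms by (auto simp: args_def universe_reduced_power)
  then obtain \<sigma>s where "\<sigma>s \<in> lists (universe (ualg_power U (Field \<kappa>)))" "Xs = map (quot_map U \<kappa>) \<sigma>s"
    unfolding lists_image by blast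
  then show thesis using that[of \<sigma>s] assms by (auto simp: args_def)
qed

text \<open>A single instance of the homomorphism law involves only finitely many sequences: the
  arguments and the value. Hence \<open>T\<close> may depend on the finite set, as it must when
  different sequences stabilise at different stages.\<close>

lemma hom_reduced_power:
  assumes U: "universal_algebra U"
    and E: "\<And>S. finite S \<Longrightarrow> S \<subseteq> universe (ualg_power U (Field \<kappa>)) \<Longrightarrow>
      \<exists>T\<in>ualg_hom (ualg_power U (Field \<kappa>)) (ualg_power U (Field \<kappa>)).
        \<forall>\<sigma>\<in>S. E (quot_map U \<kappa> \<sigma>) = quot_map U \<kappa> (T \<sigma>)"
  shows "E \<in> ualg_hom (reduced_power U \<kappa>) (reduced_power U \<kappa>)"
  unfolding ualg_hom_def
proof (intro CollectI conjI ballI refl Pi_I)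
  fix X assume "X \<in> universe (reduced_power U \<kappa>)"
  then obtain \<sigma> where \<sigma>: "\<sigma> \<in> universe (ualg_power U (Field \<kappa>))" "X = quot_map U \<kappa> \<sigma>"
    by (auto simp: universe_reduced_power)
  then show "E X \<in> universe (reduced_power U \<kappa>)"
    using E[of "{\<sigma>}"] ualg_hom_in[of _ "ualg_power U (Field \<kappa>)" "ualg_power U (Field \<kappa>)" \<sigma>]
    by (auto simp: universe_reduced_power)
next
  let ?P = "ualg_power U (Field \<kappa>)"
  fix s Xs assume s: "s \<in> symbols (reduced_power U \<kappa>)" and Xs: "Xs \<in> args (reduced_power U \<kappa>) s"
  obtain \<sigma>s where \<sigma>s: "\<sigma>s \<in> args ?P s" "Xs = map (quot_map U \<kappa>) \<sigma>s"
    by (rule args_reduced_power[OF Xs])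
  have s: "s \<in> symbols U" using s by simp
  have "insert (interp ?P s \<sigma>s) (set \<sigma>s) \<subseteq> universe ?P"
    using \<sigma>s(1) interp_power_in_universe[OF U s] by (auto simp: args_def)
  then obtain T where T: "T \<in> ualg_hom ?P ?P"
    and ET: "\<forall>\<sigma>\<in>insert (interp ?P s \<sigma>s) (set \<sigma>s). E (quot_map U \<kappa> \<sigma>) = quot_map U \<kappa> (T \<sigma>)"
    using E[of "insert (interp ?P s \<sigma>s) (set \<sigma>s)"] by auto
  have T\<sigma>s: "map T \<sigma>s \<in> args ?P s" "T (interp ?P s \<sigma>s) = interp ?P s (map T \<sigma>s)"
    using T \<sigma>s(1) s by (auto simp: ualg_hom_def args_def)
  have "E (interp (reduced_power U \<kappa>) s Xs) = quot_map U \<kappa> (T (interp ?P s \<sigma>s))"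
    using ET by (simp add: \<sigma>s(2) interp_reduced_power[OF U s \<sigma>s(1)])
  also have "\<dots> = interp (reduced_power U \<kappa>) s (map (quot_map U \<kappa>) (map T \<sigma>s))"
    by (simp only: T\<sigma>s(2) interp_reduced_power[OF U s T\<sigma>s(1)])
  also have "map (quot_map U \<kappa>) (map T \<sigma>s) = map E Xs"
    using ET by (simp add: \<sigma>s(2))
  finally show "E (interp (reduced_power U \<kappa>) s Xs) = interp (reduced_power U \<kappa>) s (map E Xs)" .
qed

end

section \<open>The averaging projection\<close>

lemma hom_restrict_universe:
  "h \<in> ualg_hom A B \<Longrightarrow> S \<subseteq> universe A \<Longrightarrow> h \<in> ualg_hom (A\<lparr>universe := S\<rparr>) B"
  unfolding ualg_hom_def args_def by (auto simp: subset_iff)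

text \<open>Interface between combinatorics and algebra: \<open>capture\<close> makes averages
  stabilise, and \<open>escape\<close> supplies the partners outside prescribed small
  supports.\<close>

locale averaging_system = regular_cardinal \<kappa> for \<kappa> :: "'k rel" +
  fixes U :: "('a, 's) ualg" and Av :: "'a \<times> 'a \<Rightarrow> 'a"
    and r :: "'d rel" and q :: "'d \<Rightarrow> 'k \<Rightarrow> 'k" and A :: "'k set"
  assumes U: "universal_algebra U" and U_nonempty: "universe U \<noteq> {}" and Av: "average U Av"
    and r: "Well_order r" and A_subset: "A \<subseteq> Field \<kappa>" and A_card: "|A| =o \<kappa>"
    and q: "\<And>\<xi> \<alpha>. \<alpha> \<in> Field \<kappa> \<Longrightarrow> q \<xi> \<alpha> \<in> Field \<kappa> \<and> q \<xi> (q \<xi> \<alpha>) = \<alpha> \<and> (q \<xi> \<alpha> \<in> A \<longleftrightarrow> \<alpha> \<notin> A)"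
    and capture: "\<And>\<sigma>. \<sigma> \<in> Field \<kappa> \<rightarrow> universe U \<Longrightarrow> \<exists>\<xi>\<in>Field r. \<forall>\<eta>. (\<xi>, \<eta>) \<in> r \<longrightarrow>
      eventually (\<lambda>\<alpha>. \<sigma> (q \<eta> \<alpha>) = \<sigma> (q \<xi> \<alpha>)) co_small"
    and escape: "\<And>Y C. |C| <o \<kappa> \<Longrightarrow> eventually (\<lambda>\<alpha>. |Y \<alpha> :: 'k set| \<le>o |C :: 'k set| ) co_small \<Longrightarrow>
      \<exists>\<xi>\<in>Field r. \<exists>B\<subseteq>A. |B| =o \<kappa> \<and> (\<forall>\<alpha>\<in>B. q \<xi> \<alpha> \<notin> Y \<alpha>) \<and>
        (\<forall>\<eta>. (\<xi>, \<eta>) \<in> r \<longrightarrow> eventually (\<lambda>\<alpha>. \<alpha> \<in> B \<longrightarrow> q \<eta> \<alpha> = q \<xi> \<alpha>) co_small)"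
begin

abbreviation P where "P \<equiv> ualg_power U (Field \<kappa>)"
abbreviation quot where "quot \<equiv> quot_map U \<kappa>"

lemma Av_idem: "x \<in> universe U \<Longrightarrow> Av (x, x) = x"
  and Av_commute: "x \<in> universe U \<Longrightarrow> y \<in> universe U \<Longrightarrow> Av (x, y) = Av (y, x)"
  using Av unfolding average_def by blast+

lemma q_Field: "\<alpha> \<in> Field \<kappa> \<Longrightarrow> q \<xi> \<alpha> \<in> Field \<kappa>"
  and q_q: "\<alpha> \<in> Field \<kappa> \<Longrightarrow> q \<xi> (q \<xi> \<alpha>) = \<alpha>"
  and q_A: "\<alpha> \<in> Field \<kappa> \<Longrightarrow> q \<xi> \<alpha> \<in> A \<longleftrightarrow> \<alpha> \<notin> A"
  using q by blast+

lemma bij_q: "bij_betw (q \<xi>) (Field \<kappa>) (Field \<kappa>)"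
  by (rule bij_betw_byWitness[of _ "q \<xi>"]) (auto simp: q_q q_Field)

lemma power_coord: "\<sigma> \<in> universe P \<Longrightarrow> \<alpha> \<in> Field \<kappa> \<Longrightarrow> \<sigma> \<alpha> \<in> universe U"
  by (auto simp: universe_power)

definition avg :: "'d \<Rightarrow> ('k \<Rightarrow> 'a) \<Rightarrow> 'k \<Rightarrow> 'a" where
  "avg \<xi> \<sigma> = (\<lambda>\<alpha>\<in>Field \<kappa>. Av (\<sigma> \<alpha>, \<sigma> (q \<xi> \<alpha>)))"

lemma avg_apply: "\<alpha> \<in> Field \<kappa> \<Longrightarrow> avg \<xi> \<sigma> \<alpha> = Av (\<sigma> \<alpha>, \<sigma> (q \<xi> \<alpha>))"
  by (simp add: avg_def)

lemma avg_hom: "avg \<xi> \<in> ualg_hom P P"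
  unfolding avg_def[abs_def] by (rule average_hom[OF Av]) (auto simp: q_Field)

lemma avg_in: "\<sigma> \<in> universe P \<Longrightarrow> avg \<xi> \<sigma> \<in> universe P"
  by (rule ualg_hom_in[OF avg_hom])

lemma avg_q:
  assumes "\<sigma> \<in> universe P" "\<alpha> \<in> Field \<kappa>"
  shows "avg \<xi> \<sigma> (q \<xi> \<alpha>) = avg \<xi> \<sigma> \<alpha>"
  using assms by (simp add: avg_apply q_Field q_q Av_commute power_coord)

text \<open>An averaged sequence takes equal values on partners, by symmetry of \<open>Av\<close>,
  so averaging it again over the same matching changes nothing.\<close>

lemma avg_avg:
  assumes "\<sigma> \<in> universe P"
  shows "avg \<xi> (avg \<xi> \<sigma>) = avg \<xi> \<sigma>"
proof
  fix \<alpha> show "avg \<xi> (avg \<xi> \<sigma>) \<alpha> = avg \<xi> \<sigma> \<alpha>"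
  proof (cases "\<alpha> \<in> Field \<kappa>")
    case True
    then show ?thesis
      using avg_apply[OF True, of \<xi> "avg \<xi> \<sigma>"] avg_q[OF assms True, of \<xi>]
        Av_idem[OF power_coord[OF avg_in[OF assms] True]] by simp
  qed (simp add: avg_def)
qed

lemma avg_cong:
  assumes "\<sigma> \<in> universe P" "\<tau> \<in> universe P" "quot \<sigma> = quot \<tau>"
  shows "quot (avg \<xi> \<sigma>) = quot (avg \<xi> \<tau>)"
proof -
  have ev: "eventually (\<lambda>\<alpha>. \<sigma> \<alpha> = \<tau> \<alpha>) co_small" using assms by (simp add: quot_map_eq_iff)
  from ev eventually_reindex[OF ev bij_q, of \<xi>] eventually_Field
  have "eventually (\<lambda>\<alpha>. avg \<xi> \<sigma> \<alpha> = avg \<xi> \<tau> \<alpha>) co_small"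
    by eventually_elim (simp add: avg_apply)
  then show ?thesis using assms by (simp add: quot_map_eq_iff avg_in)
qed

section \<open>Stabilisation of the averages along the stages\<close>

definition captured :: "('k \<Rightarrow> 'a) \<Rightarrow> 'd \<Rightarrow> bool" where
  "captured \<sigma> \<xi> \<longleftrightarrow> \<xi> \<in> Field r \<and>
    (\<forall>\<eta>. (\<xi>, \<eta>) \<in> r \<longrightarrow> eventually (\<lambda>\<alpha>. \<sigma> (q \<eta> \<alpha>) = \<sigma> (q \<xi> \<alpha>)) co_small)"

lemma ex_captured: "\<sigma> \<in> universe P \<Longrightarrow> \<exists>\<xi>. captured \<sigma> \<xi>"
  using capture[of \<sigma>] unfolding captured_def universe_power by blast

lemma avg_captured:
  assumes "\<sigma> \<in> universe P" "captured \<sigma> \<xi>" "(\<xi>, \<eta>) \<in> r"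
  shows "quot (avg \<eta> \<sigma>) = quot (avg \<xi> \<sigma>)"
proof -
  have "eventually (\<lambda>\<alpha>. \<sigma> (q \<eta> \<alpha>) = \<sigma> (q \<xi> \<alpha>)) co_small"
    using assms(2,3) unfolding captured_def by blast
  with eventually_Field have "eventually (\<lambda>\<alpha>. avg \<eta> \<sigma> \<alpha> = avg \<xi> \<sigma> \<alpha>) co_small"
    by eventually_elim (simp add: avg_apply)
  then show ?thesis using assms(1) by (simp add: quot_map_eq_iff avg_in)
qed

lemma wo_r: "wo_rel r"
  using r unfolding wo_rel_def .

lemma r_refl: "\<xi> \<in> Field r \<Longrightarrow> (\<xi>, \<xi>) \<in> r"
  using wo_rel.REFL[OF wo_r] unfolding refl_on_def by blast

lemma r_trans: "(\<xi>, \<eta>) \<in> r \<Longrightarrow> (\<eta>, \<zeta>) \<in> r \<Longrightarrow> (\<xi>, \<zeta>) \<in> r"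
  using wo_rel.TRANS[OF wo_r] by (rule transD)

lemma r_upper:
  assumes "\<xi> \<in> Field r" "\<eta> \<in> Field r"
  obtains \<zeta> where "(\<xi>, \<zeta>) \<in> r" "(\<eta>, \<zeta>) \<in> r"
  using wo_rel.TOTALS[OF wo_r] r_refl assms by metis

text \<open>The representative and the stage are both arbitrary choices; \<open>proj_eq\<close>
  shows that neither affects the value.\<close>

definition proj :: "('k \<Rightarrow> 'a) set \<Rightarrow> ('k \<Rightarrow> 'a) set" where
  "proj X = (let \<sigma> = (SOME \<sigma>. \<sigma> \<in> universe P \<and> quot \<sigma> = X) in quot (avg (SOME \<xi>. captured \<sigma> \<xi>) \<sigma>))"

text \<open>Two representatives of one class are compared at a stage above both of their capturing
  stages: there each average has stabilised, and averaging over a single matching respects the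
  congruence.\<close>

lemma proj_eq:
  assumes \<sigma>: "\<sigma> \<in> universe P" and \<xi>: "captured \<sigma> \<xi>" and \<eta>: "(\<xi>, \<eta>) \<in> r"
  shows "proj (quot \<sigma>) = quot (avg \<eta> \<sigma>)"
proof -
  define \<sigma>' where "\<sigma>' = (SOME \<sigma>'. \<sigma>' \<in> universe P \<and> quot \<sigma>' = quot \<sigma>)"
  define \<xi>' where "\<xi>' = (SOME \<xi>'. captured \<sigma>' \<xi>')"
  have \<sigma>': "\<sigma>' \<in> universe P" "quot \<sigma>' = quot \<sigma>"
    using someI[of "\<lambda>\<sigma>'. \<sigma>' \<in> universe P \<and> quot \<sigma>' = quot \<sigma>" \<sigma>] \<sigma> unfolding \<sigma>'_def by auto
  have \<xi>': "captured \<sigma>' \<xi>'"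
    unfolding \<xi>'_def using someI_ex[OF ex_captured[OF \<sigma>'(1)]] .
  obtain \<zeta> where \<zeta>: "(\<xi>, \<zeta>) \<in> r" "(\<xi>', \<zeta>) \<in> r"
    using r_upper \<xi> \<xi>' unfolding captured_def by metis
  have "proj (quot \<sigma>) = quot (avg \<xi>' \<sigma>')"
    unfolding proj_def \<xi>'_def \<sigma>'_def Let_def ..
  also have "\<dots> = quot (avg \<zeta> \<sigma>')" using avg_captured[OF \<sigma>'(1) \<xi>' \<zeta>(2)] by simp
  also have "\<dots> = quot (avg \<zeta> \<sigma>)" using avg_cong[OF \<sigma>'(1) \<sigma> \<sigma>'(2)] .
  also have "\<dots> = quot (avg \<xi> \<sigma>)" using avg_captured[OF \<sigma> \<xi> \<zeta>(1)] .
  also have "\<dots> = quot (avg \<eta> \<sigma>)" using avg_captured[OF \<sigma> \<xi> \<eta>] by simp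
  finally show ?thesis .
qed

text \<open>Finitely many stages have an upper bound in the linear order \<open>r\<close>. The
  prescribed lower bound allows going beyond a stage at which something else was fixed, such as the
  pairs given by \<open>escape\<close>.\<close>

lemma common_stage:
  assumes "finite S" "S \<subseteq> universe P" "\<xi>\<^sub>0 \<in> Field r"
  shows "\<exists>\<eta>. (\<xi>\<^sub>0, \<eta>) \<in> r \<and> (\<forall>\<sigma>\<in>S. proj (quot \<sigma>) = quot (avg \<eta> \<sigma>))"
proof -
  have "\<exists>\<eta>. (\<xi>\<^sub>0, \<eta>) \<in> r \<and> (\<forall>\<sigma>\<in>S. \<exists>\<xi>. captured \<sigma> \<xi> \<and> (\<xi>, \<eta>) \<in> r)"
    using assms(1,2)
  proof induction
    case empty
    then show ?case using r_refl[OF assms(3)] by blast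
  next
    case (insert \<sigma> S)
    then obtain \<eta> where \<eta>: "(\<xi>\<^sub>0, \<eta>) \<in> r" "\<forall>\<sigma>\<in>S. \<exists>\<xi>. captured \<sigma> \<xi> \<and> (\<xi>, \<eta>) \<in> r" by auto
    obtain \<xi> where \<xi>: "captured \<sigma> \<xi>" using insert ex_captured by blast
    have "\<eta> \<in> Field r" "\<xi> \<in> Field r" using \<eta>(1) \<xi> unfolding captured_def by (auto intro: FieldI2)
    then obtain \<zeta> where "(\<eta>, \<zeta>) \<in> r" "(\<xi>, \<zeta>) \<in> r" by (rule r_upper)
    then show ?case using \<eta> \<xi> r_trans by blast
  qed
  then obtain \<eta> where "(\<xi>\<^sub>0, \<eta>) \<in> r" "\<forall>\<sigma>\<in>S. \<exists>\<xi>. captured \<sigma> \<xi> \<and> (\<xi>, \<eta>) \<in> r" by blast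
  then show ?thesis using assms(2) proj_eq by blast
qed

lemma ex_stage: "\<exists>\<xi>. \<xi> \<in> Field r"
proof -
  obtain x where "x \<in> universe U" using U_nonempty by blast
  then have "(\<lambda>\<alpha>\<in>Field \<kappa>. x) \<in> universe P" by (simp add: universe_power)
  then show ?thesis using ex_captured unfolding captured_def by blast
qed

lemma common_stage_any:
  assumes "finite S" "S \<subseteq> universe P"
  shows "\<exists>\<eta>. \<forall>\<sigma>\<in>S. proj (quot \<sigma>) = quot (avg \<eta> \<sigma>)"
  using ex_stage common_stage[OF assms] by blast

lemma proj_hom: "proj \<in> ualg_hom (reduced_power U \<kappa>) (reduced_power U \<kappa>)"
proof (rule hom_reduced_power[OF U])
  fix S assume "finite S" "S \<subseteq> universe P"
  then obtain \<eta> where "\<forall>\<sigma>\<in>S. proj (quot \<sigma>) = quot (avg \<eta> \<sigma>)"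
    using common_stage_any by blast
  then show "\<exists>T\<in>ualg_hom P P. \<forall>\<sigma>\<in>S. proj (quot \<sigma>) = quot (T \<sigma>)"
    using avg_hom by blast
qed

text \<open>The average at stage \<xi> is a new sequence and may be captured only later, at \<eta>.
  At \<eta> it can be exchanged for the average of \<sigma> at \<eta> itself, since both represent
  one class, and averaging at one stage is idempotent.\<close>

lemma proj_proj:
  assumes "X \<in> universe (reduced_power U \<kappa>)"
  shows "proj (proj X) = proj X"
proof -
  obtain \<sigma> where \<sigma>: "\<sigma> \<in> universe P" "X = quot \<sigma>" using assms by (auto simp: universe_reduced_power)
  obtain \<xi> where \<xi>: "captured \<sigma> \<xi>" using ex_captured[OF \<sigma>(1)] by blast
  then have \<xi>r: "\<xi> \<in> Field r" unfolding captured_def by blast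
  obtain \<eta> where \<eta>: "(\<xi>, \<eta>) \<in> r" "proj (quot (avg \<xi> \<sigma>)) = quot (avg \<eta> (avg \<xi> \<sigma>))"
    using common_stage[of "{avg \<xi> \<sigma>}" \<xi>] \<xi>r avg_in[OF \<sigma>(1)] by auto
  have *: "quot (avg \<eta> \<sigma>) = quot (avg \<xi> \<sigma>)" by (rule avg_captured[OF \<sigma>(1) \<xi> \<eta>(1)])
  have "proj X = quot (avg \<xi> \<sigma>)" unfolding \<sigma>(2) by (rule proj_eq[OF \<sigma>(1) \<xi> r_refl[OF \<xi>r]])
  moreover have "quot (avg \<eta> (avg \<xi> \<sigma>)) = quot (avg \<eta> (avg \<eta> \<sigma>))"
    by (rule avg_cong) (simp_all add: avg_in \<sigma>(1) *)
  ultimately show ?thesis using \<eta>(2) * by (simp add: avg_avg \<sigma>(1))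
qed

text \<open>Elements of the image are invariant under some matching, hence determined by their
  restriction to the transversal \<open>A\<close>; as \<open>A\<close> has size \<kappa>,
  restriction followed by reindexing is the isomorphism.\<close>

lemma proj_image_isomorphic:
  "ualg_isomorphic (hom_image proj (reduced_power U \<kappa>) (reduced_power U \<kappa>)) (reduced_power U \<kappa>)"
proof -
  have "|Field \<kappa>| =o |A|" using card_Field A_card ordIso_symmetric ordIso_transitive by blast
  then obtain i where i: "bij_betw i (Field \<kappa>) A" unfolding card_of_ordIso[symmetric] by blast
  have i_in: "i \<gamma> \<in> A" "i \<gamma> \<in> Field \<kappa>" if "\<gamma> \<in> Field \<kappa>" for \<gamma>
    using bij_betwE[OF i] that A_subset by auto
  define D where "D \<tau> = (\<lambda>\<gamma>\<in>Field \<kappa>. \<tau> (i \<gamma>))" for \<tau> :: "'k \<Rightarrow> 'a"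
  have D_hom: "D \<in> ualg_hom P P"
    unfolding D_def[abs_def] by (rule reindex_hom) (use i_in in auto)
  have D_in: "D \<tau> \<in> universe P" if "\<tau> \<in> universe P" for \<tau>
    by (rule ualg_hom_in[OF D_hom that])
  have ev_D: "eventually (\<lambda>\<gamma>. D \<sigma> \<gamma> = D \<tau> \<gamma>) co_small \<longleftrightarrow>
    eventually (\<lambda>\<alpha>. \<alpha> \<in> A \<longrightarrow> \<sigma> \<alpha> = \<tau> \<alpha>) co_small" for \<sigma> \<tau>
  proof -
    have "{\<alpha> \<in> Field \<kappa>. \<not> (\<alpha> \<in> A \<longrightarrow> \<sigma> \<alpha> = \<tau> \<alpha>)} = i ` {\<gamma> \<in> Field \<kappa>. D \<sigma> \<gamma> \<noteq> D \<tau> \<gamma>}"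
      using bij_betw_imp_surj_on[OF i] A_subset by (auto simp: D_def)
    moreover have "|i ` {\<gamma> \<in> Field \<kappa>. D \<sigma> \<gamma> \<noteq> D \<tau> \<gamma>}| <o \<kappa> \<longleftrightarrow> |{\<gamma> \<in> Field \<kappa>. D \<sigma> \<gamma> \<noteq> D \<tau> \<gamma>}| <o \<kappa>"
      using small_image[of "{\<gamma> \<in> Field \<kappa>. D \<sigma> \<gamma> \<noteq> D \<tau> \<gamma>}" i]
        small_inj_vimage[of "i ` {\<gamma> \<in> Field \<kappa>. D \<sigma> \<gamma> \<noteq> D \<tau> \<gamma>}" i "{\<gamma> \<in> Field \<kappa>. D \<sigma> \<gamma> \<noteq> D \<tau> \<gamma>}"]
        inj_on_subset[OF bij_betw_imp_inj_on[OF i], of "{\<gamma> \<in> Field \<kappa>. D \<sigma> \<gamma> \<noteq> D \<tau> \<gamma>}"] by auto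
    ultimately show ?thesis by (simp add: eventually_co_small)
  qed
  define h where "h X = quot (D (SOME \<tau>. \<tau> \<in> universe P \<and> quot \<tau> = X))" for X
  have h: "h (quot \<tau>) = quot (D \<tau>)" if \<tau>: "\<tau> \<in> universe P" for \<tau>
  proof -
    define \<tau>' where "\<tau>' = (SOME \<tau>'. \<tau>' \<in> universe P \<and> quot \<tau>' = quot \<tau>)"
    have \<tau>': "\<tau>' \<in> universe P" "quot \<tau>' = quot \<tau>"
      using someI[of "\<lambda>\<tau>'. \<tau>' \<in> universe P \<and> quot \<tau>' = quot \<tau>" \<tau>] \<tau> unfolding \<tau>'_def by auto
    then have "eventually (\<lambda>\<alpha>. \<tau>' \<alpha> = \<tau> \<alpha>) co_small" using \<tau> by (simp add: quot_map_eq_iff)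
    then have "eventually (\<lambda>\<alpha>. \<alpha> \<in> A \<longrightarrow> \<tau>' \<alpha> = \<tau> \<alpha>) co_small" by (rule eventually_mono) simp
    then show ?thesis
      unfolding h_def \<tau>'_def[symmetric] using \<tau> \<tau>'(1) by (simp add: quot_map_eq_iff D_in ev_D)
  qed
  have h_hom: "h \<in> ualg_hom (reduced_power U \<kappa>) (reduced_power U \<kappa>)"
    by (rule hom_reduced_power[OF U]) (use D_hom h in blast)
  have sub: "proj ` universe (reduced_power U \<kappa>) \<subseteq> universe (reduced_power U \<kappa>)"
    using ualg_hom_in[OF proj_hom] by blast
  have "inj_on h (proj ` universe (reduced_power U \<kappa>))"
  proof (rule inj_onI)
    fix X Y assume XY: "X \<in> proj ` universe (reduced_power U \<kappa>)" "Y \<in> proj ` universe (reduced_power U \<kappa>)"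
      and eq: "h X = h Y"
    obtain \<sigma> \<tau> where \<sigma>: "\<sigma> \<in> universe P" "X = proj (quot \<sigma>)" and \<tau>: "\<tau> \<in> universe P" "Y = proj (quot \<tau>)"
      using XY by (auto simp: universe_reduced_power)
    obtain \<eta> where \<eta>: "X = quot (avg \<eta> \<sigma>)" "Y = quot (avg \<eta> \<tau>)"
      using common_stage_any[of "{\<sigma>, \<tau>}"] \<sigma> \<tau> by auto
    have ev: "eventually (\<lambda>\<alpha>. \<alpha> \<in> A \<longrightarrow> avg \<eta> \<sigma> \<alpha> = avg \<eta> \<tau> \<alpha>) co_small"
      using eq \<sigma>(1) \<tau>(1) by (simp add: \<eta> h avg_in quot_map_eq_iff D_in ev_D)
    \<comment> \<open>Agreement on \<open>A\<close> is carried to the complement by the involution,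
      under which both averages are invariant.\<close>
    from ev eventually_reindex[OF ev bij_q, of \<eta>] eventually_Field
    have "eventually (\<lambda>\<alpha>. avg \<eta> \<sigma> \<alpha> = avg \<eta> \<tau> \<alpha>) co_small"
    proof eventually_elim
      case (elim \<alpha>)
      then show ?case using avg_q[OF \<sigma>(1)] avg_q[OF \<tau>(1)] q_A[of \<alpha> \<eta>] by (cases "\<alpha> \<in> A") auto
    qed
    then show "X = Y" using \<sigma>(1) \<tau>(1) by (simp add: \<eta> quot_map_eq_iff avg_in)
  qed
  moreover have "h ` proj ` universe (reduced_power U \<kappa>) = universe (reduced_power U \<kappa>)"
  proof
    show "h ` proj ` universe (reduced_power U \<kappa>) \<subseteq> universe (reduced_power U \<kappa>)"
      using sub ualg_hom_in[OF h_hom] by blast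
    show "universe (reduced_power U \<kappa>) \<subseteq> h ` proj ` universe (reduced_power U \<kappa>)"
    proof
      fix R assume "R \<in> universe (reduced_power U \<kappa>)"
      then obtain \<rho> where \<rho>: "\<rho> \<in> universe P" "R = quot \<rho>" by (auto simp: universe_reduced_power)
      obtain x where x: "x \<in> universe U" using U_nonempty by blast
      define \<rho>' where "\<rho>' = (\<lambda>\<alpha>\<in>Field \<kappa>. if \<alpha> \<in> A then \<rho> (inv_into (Field \<kappa>) i \<alpha>) else x)"
      have "\<rho>' \<in> universe P"
        using power_coord[OF \<rho>(1)] x inv_into_into[of _ i "Field \<kappa>"] bij_betw_imp_surj_on[OF i]
        by (auto simp: \<rho>'_def universe_power)
      then obtain \<xi> where \<xi>: "captured \<rho>' \<xi>" using ex_captured by blast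
      \<comment> \<open>Spreading \<open>\<rho>'\<close> over both halves along \<open>q \<xi>\<close> makes it invariant under averaging at every later stage.\<close>
      define \<sigma> where "\<sigma> = (\<lambda>\<alpha>\<in>Field \<kappa>. if \<alpha> \<in> A then \<rho>' \<alpha> else \<rho>' (q \<xi> \<alpha>))"
      have \<sigma>: "\<sigma> \<in> universe P"
        using power_coord[OF \<open>\<rho>' \<in> universe P\<close>] q_Field by (auto simp: \<sigma>_def universe_power)
      have "\<xi> \<in> Field r" using \<xi> unfolding captured_def by blast
      then obtain \<eta> where \<eta>: "(\<xi>, \<eta>) \<in> r" "proj (quot \<sigma>) = quot (avg \<eta> \<sigma>)"
        using common_stage[of "{\<sigma>}" \<xi>] \<sigma> by auto
      have ev: "eventually (\<lambda>\<alpha>. \<rho>' (q \<eta> \<alpha>) = \<rho>' (q \<xi> \<alpha>)) co_small"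
        using \<xi> \<eta>(1) unfolding captured_def by blast
      from ev eventually_reindex[OF ev bij_q, of \<eta>] eventually_Field
      have "eventually (\<lambda>\<alpha>. avg \<eta> \<sigma> \<alpha> = \<sigma> \<alpha>) co_small"
      proof eventually_elim
        case (elim \<alpha>)
        \<comment> \<open>For \<alpha> outside \<open>A\<close> the captured equality is used at
          \<alpha> itself, for \<alpha> in \<open>A\<close> at its partner
          \<open>q \<eta> \<alpha>\<close>.\<close>
        have "\<sigma> (q \<eta> \<alpha>) = \<sigma> \<alpha>"
          using elim q_A[OF elim(3), of \<eta>] q_Field[OF elim(3), of \<eta>] q_q[OF elim(3), of \<eta>]
          by (auto simp: \<sigma>_def)
        then show ?case using Av_idem[OF power_coord[OF \<sigma> elim(3)]] by (simp add: avg_apply elim(3))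
      qed
      then have "proj (quot \<sigma>) = quot \<sigma>" using \<eta>(2) \<sigma> by (simp add: quot_map_eq_iff avg_in)
      moreover have "D \<sigma> = \<rho>"
      proof
        fix \<gamma> show "D \<sigma> \<gamma> = \<rho> \<gamma>"
        proof (cases "\<gamma> \<in> Field \<kappa>")
          case True
          then show ?thesis
            using i_in[OF True] inv_into_f_f[OF bij_betw_imp_inj_on[OF i] True]
            by (simp add: D_def \<sigma>_def \<rho>'_def)
        next
          case False
          then show ?thesis using \<rho>(1) by (simp add: D_def universe_power PiE_def extensional_def)
        qed
      qed
      ultimately have "R = h (proj (quot \<sigma>))" by (simp add: h[OF \<sigma>] \<rho>(2))
      then show "R \<in> h ` proj ` universe (reduced_power U \<kappa>)"
        using \<sigma> by (auto simp: universe_reduced_power)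
    qed
  qed
  ultimately have "bij_betw h (proj ` universe (reduced_power U \<kappa>)) (universe (reduced_power U \<kappa>))"
    unfolding bij_betw_def by blast
  then show ?thesis
    using hom_restrict_universe[OF h_hom sub] unfolding ualg_isomorphic_def hom_image_def by auto
qed

text \<open>With value \<open>a\<close> on the transversal and \<open>b\<close> off it, every pair
  of every matching carries both values, so each average is \<open>Av (a, b)\<close>, different from
  both.\<close>

lemma proj_changing:
  assumes "changing U Av"
  shows "\<exists>\<sigma>\<in>universe P. \<forall>\<tau>\<in>universe P. proj (quot \<sigma>) = quot \<tau> \<longrightarrow>
    |{\<alpha> \<in> Field \<kappa>. \<sigma> \<alpha> = \<tau> \<alpha>}| <o \<kappa>"
proof -
  obtain a b where ab: "a \<in> universe U" "b \<in> universe U" "a \<noteq> Av (a, b)" "Av (a, b) \<noteq> b"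
    using assms unfolding changing_def by blast
  define \<sigma> where "\<sigma> = (\<lambda>\<alpha>\<in>Field \<kappa>. if \<alpha> \<in> A then a else b)"
  have \<sigma>: "\<sigma> \<in> universe P" using ab by (auto simp: \<sigma>_def universe_power)
  obtain \<eta> where \<eta>: "proj (quot \<sigma>) = quot (avg \<eta> \<sigma>)"
    using common_stage_any[of "{\<sigma>}"] \<sigma> by auto
  have ne: "avg \<eta> \<sigma> \<alpha> \<noteq> \<sigma> \<alpha>" if "\<alpha> \<in> Field \<kappa>" for \<alpha>
    using ab that q_A[OF that, of \<eta>] q_Field[OF that, of \<eta>] Av_commute[OF ab(1,2)]
    by (auto simp: avg_apply \<sigma>_def)
  have "|{\<alpha> \<in> Field \<kappa>. \<sigma> \<alpha> = \<tau> \<alpha>}| <o \<kappa>" if "\<tau> \<in> universe P" "proj (quot \<sigma>) = quot \<tau>" for \<tau>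
  proof -
    have "eventually (\<lambda>\<alpha>. avg \<eta> \<sigma> \<alpha> = \<tau> \<alpha>) co_small"
      using that \<sigma> \<eta> by (simp add: quot_map_eq_iff avg_in)
    then show ?thesis
      unfolding eventually_co_small by (rule card_of_subset_less[rotated]) (use ne in force)
  qed
  then show ?thesis using \<sigma> by blast
qed

text \<open>If fewer than \<kappa> coordinates lacked a small support, \<open>escape\<close> would
  place the partner of \<alpha> outside the support of \<alpha> for \<kappa> many \<alpha>, and
  thinning to a sparse set would exclude the partners of later \<alpha> as well. The lift at
  \<alpha> is then committed while the value at the partner is still free, and a diagonal sequence
  refutes it.\<close>

lemma lift_without_small_support:
  fixes \<mu> :: "'k rel"
  assumes ab: "a \<in> universe U" "b \<in> universe U" "Av (a, b) \<noteq> a"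
    and \<Delta>: "\<Delta> \<in> ualg_hom P P" "\<And>\<sigma>. \<sigma> \<in> universe P \<Longrightarrow> quot (\<Delta> \<sigma>) = proj (quot \<sigma>)"
    and \<mu>: "Card_order \<mu>" "\<mu> <o \<kappa>"
  shows "|{\<alpha> \<in> Field \<kappa>. \<not> (\<exists>Y. strong_support U (Field \<kappa>) ((\<lambda>\<sigma>. \<sigma> \<alpha>) \<circ> \<Delta>) Y \<and> |Y| \<le>o \<mu>)}| =o \<kappa>"
    (is "|?N| =o \<kappa>")
proof (rule ccontr)
  assume "\<not> |?N| =o \<kappa>"
  then have N: "|?N| <o \<kappa>" using card_of_subset_Field[of ?N] by blast
  define Y where "Y \<alpha> = (SOME Y. strong_support U (Field \<kappa>) ((\<lambda>\<sigma>. \<sigma> \<alpha>) \<circ> \<Delta>) Y \<and> |Y| \<le>o \<mu>)" for \<alpha>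
  have Y: "strong_support U (Field \<kappa>) ((\<lambda>\<sigma>. \<sigma> \<alpha>) \<circ> \<Delta>) (Y \<alpha>) \<and> |Y \<alpha>| \<le>o \<mu>" if "\<alpha> \<in> Field \<kappa> - ?N" for \<alpha>
    unfolding Y_def by (rule someI_ex) (use that in blast)
  have \<Delta>_eq: "\<Delta> \<sigma> \<alpha> = \<Delta> \<tau> \<alpha>"
    if "\<alpha> \<in> Field \<kappa> - ?N" "\<sigma> \<in> universe P" "\<tau> \<in> universe P" "\<And>\<beta>. \<beta> \<in> Y \<alpha> \<Longrightarrow> \<sigma> \<beta> = \<tau> \<beta>" for \<alpha> \<sigma> \<tau>
  proof -
    have "restrict \<sigma> (Y \<alpha>) = restrict \<tau> (Y \<alpha>)" using that(4) by (auto intro: restrict_ext)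
    moreover have "strong_support U (Field \<kappa>) ((\<lambda>\<sigma>. \<sigma> \<alpha>) \<circ> \<Delta>) (Y \<alpha>)"
      using Y[OF that(1)] by (rule conjunct1)
    then have "\<forall>\<sigma>\<in>universe P. \<forall>\<tau>\<in>universe P. restrict \<sigma> (Y \<alpha>) = restrict \<tau> (Y \<alpha>) \<longrightarrow>
        ((\<lambda>\<sigma>. \<sigma> \<alpha>) \<circ> \<Delta>) \<sigma> = ((\<lambda>\<sigma>. \<sigma> \<alpha>) \<circ> \<Delta>) \<tau>"
      unfolding strong_support_def by (elim conjE)
    ultimately have "((\<lambda>\<sigma>. \<sigma> \<alpha>) \<circ> \<Delta>) \<sigma> = ((\<lambda>\<sigma>. \<sigma> \<alpha>) \<circ> \<Delta>) \<tau>" using that(2,3) by blast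
    then show ?thesis by (simp only: comp_apply)
  qed
  have \<mu>F: "|Field \<mu>| =o \<mu>" using \<mu>(1) by (rule card_of_Field_ordIso)
  have C: "|Field \<mu>| <o \<kappa>" using ordIso_ordLess_trans[OF \<mu>F \<mu>(2)] .
  have "eventually (\<lambda>\<alpha>. |Y \<alpha>| \<le>o |Field \<mu>| ) co_small"
    using eventually_not_small[OF N] eventually_Field
  proof eventually_elim
    case (elim \<alpha>)
    then have "|Y \<alpha>| \<le>o \<mu>" using Y[of \<alpha>] by blast
    then show ?case using \<mu>F ordIso_symmetric ordLeq_ordIso_trans by blast
  qed
  from escape[OF C this] obtain \<xi> B where \<xi>: "\<xi> \<in> Field r" and B: "B \<subseteq> A" "|B| =o \<kappa>"
    and esc: "\<forall>\<alpha>\<in>B. q \<xi> \<alpha> \<notin> Y \<alpha>"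
    and stable: "\<forall>\<eta>. (\<xi>, \<eta>) \<in> r \<longrightarrow> eventually (\<lambda>\<alpha>. \<alpha> \<in> B \<longrightarrow> q \<eta> \<alpha> = q \<xi> \<alpha>) co_small"
    by blast
  have BF: "B - ?N \<subseteq> Field \<kappa>" using B(1) A_subset by blast
  have "\<not> |B - ?N| <o \<kappa>"
  proof
    assume "|B - ?N| <o \<kappa>"
    from small_Un[OF this N] have "|B| <o \<kappa>" by (rule card_of_subset_less[rotated]) blast
    then show False using B(2) not_ordLess_ordIso by blast
  qed
  moreover have "|Y \<alpha>| <o \<kappa>" if "\<alpha> \<in> B - ?N" for \<alpha>
    using Y[of \<alpha>] that BF \<mu>(2) ordLeq_ordLess_trans by blast
  moreover have "inj_on (q \<xi>) (B - ?N)"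
    using bij_betw_imp_inj_on[OF bij_q] BF by (rule inj_on_subset)
  ultimately obtain K where K: "K \<subseteq> B - ?N" "\<not> |K| <o \<kappa>"
    and sparse: "\<forall>\<alpha>\<in>K. \<forall>\<alpha>'\<in>K. \<alpha> \<in> underS \<kappa> \<alpha>' \<longrightarrow> q \<xi> \<alpha>' \<notin> Y \<alpha>"
    using sparse_subset[OF BF, of Y "q \<xi>"] by auto
  define t where "t D = (\<lambda>\<alpha>\<in>Field \<kappa>. if \<alpha> \<in> q \<xi> ` D then b else a)" for D
  have t: "t D \<in> universe P" for D using ab by (auto simp: t_def universe_power)
  \<comment> \<open>At \<open>\<alpha> \<in> K\<close> the lift does not see the coordinate \<open>q \<xi> \<alpha>\<close>, so the value there can be chosen,
    by recursion on \<open>\<alpha>\<close>, to make the average differ from what the lift has already committed to.\<close>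
  obtain D where D: "D \<subseteq> K" "\<forall>\<alpha>\<in>K. \<alpha> \<in> D \<longleftrightarrow> \<Delta> (t (D \<inter> underS \<kappa> \<alpha>)) \<alpha> = a"
    using diagonal_subset[of K "\<lambda>D \<alpha>. \<Delta> (t D) \<alpha> = a"] by blast
  have differ: "\<Delta> (t D) \<alpha> \<noteq> Av (t D \<alpha>, t D (q \<xi> \<alpha>))" if \<alpha>: "\<alpha> \<in> K" for \<alpha>
  proof -
    have \<alpha>F: "\<alpha> \<in> Field \<kappa> - ?N" "\<alpha> \<in> A" "\<alpha> \<in> B" using \<alpha> K(1) BF B(1) by auto
    have "\<Delta> (t D) \<alpha> = \<Delta> (t (D \<inter> underS \<kappa> \<alpha>)) \<alpha>"
    proof (rule \<Delta>_eq[OF \<alpha>F(1) t t])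
      fix \<beta> assume \<beta>: "\<beta> \<in> Y \<alpha>"
      \<comment> \<open>Only partners of points below \<alpha> can lie in the support:
        \<open>escape\<close> excludes the partner of \<alpha>, sparseness those of later
        points.\<close>
      have "\<delta> \<in> underS \<kappa> \<alpha>" if \<delta>: "\<delta> \<in> D" "\<beta> = q \<xi> \<delta>" for \<delta>
      proof -
        have "\<delta> \<in> K" "\<delta> \<in> Field \<kappa>" using \<delta>(1) D(1) K(1) BF by auto
        then have "\<alpha> \<notin> underS \<kappa> \<delta>" using sparse \<alpha> \<beta> \<delta>(2) by blast
        moreover have "\<delta> \<noteq> \<alpha>" using esc \<alpha>F(3) \<beta> \<delta>(2) by blast
        ultimately show ?thesis
          using wo_rel.TOTALS[OF wo] \<open>\<delta> \<in> Field \<kappa>\<close> \<alpha>F(1) unfolding underS_def by blast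
      qed
      then show "t D \<beta> = t (D \<inter> underS \<kappa> \<alpha>) \<beta>" by (auto simp: t_def)
    qed
    then have "\<alpha> \<in> D \<longleftrightarrow> \<Delta> (t D) \<alpha> = a" using D(2) \<alpha> by simp
    moreover have "t D \<alpha> = a"
    proof -
      have "\<alpha> \<notin> q \<xi> ` D"
        using \<alpha>F(2) D(1) K(1) B(1) BF q_A by blast
      then show ?thesis using \<alpha>F(1) by (simp add: t_def)
    qed
    moreover have "t D (q \<xi> \<alpha>) = (if \<alpha> \<in> D then b else a)"
    proof -
      have "q \<xi> \<alpha> \<in> q \<xi> ` D \<longleftrightarrow> \<alpha> \<in> D"
        using inj_on_image_mem_iff[OF bij_betw_imp_inj_on[OF bij_q], of \<alpha> D \<xi>] D(1) K(1) BF \<alpha>F(1) by blast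
      then show ?thesis using \<alpha>F(1) q_Field by (simp add: t_def)
    qed
    \<comment> \<open>If \<alpha> is in \<open>D\<close>, the lift gives \<open>a\<close> and the
      average is \<open>Av (a, b)\<close>; otherwise the average is \<open>a\<close> and the lift
      gives something else.\<close>
    ultimately show ?thesis using ab(3) Av_idem[OF ab(1)] by (cases "\<alpha> \<in> D") auto
  qed
  \<comment> \<open>The stage computing the projection is taken after \<xi>, so that the escaping
    pairs are still present there.\<close>
  obtain \<eta> where \<eta>: "(\<xi>, \<eta>) \<in> r" "proj (quot (t D)) = quot (avg \<eta> (t D))"
    using common_stage[of "{t D}" \<xi>] t \<xi> by auto
  have "quot (\<Delta> (t D)) = quot (avg \<eta> (t D))" using \<Delta>(2)[OF t] \<eta>(2) by simp
  then have "eventually (\<lambda>\<alpha>. \<Delta> (t D) \<alpha> = avg \<eta> (t D) \<alpha>) co_small"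
    using quot_map_eq_iff ualg_hom_in[OF \<Delta>(1) t] avg_in[OF t] by blast
  moreover have "eventually (\<lambda>\<alpha>. \<alpha> \<in> B \<longrightarrow> q \<eta> \<alpha> = q \<xi> \<alpha>) co_small" using stable \<eta>(1) by blast
  ultimately have "eventually (\<lambda>\<alpha>. \<alpha> \<notin> K) co_small"
    using eventually_Field
  proof eventually_elim
    case (elim \<alpha>)
    show ?case
    proof
      assume "\<alpha> \<in> K"
      then have "\<Delta> (t D) \<alpha> = Av (t D \<alpha>, t D (q \<xi> \<alpha>))" using elim K(1) by (auto simp: avg_apply)
      then show False using differ[OF \<open>\<alpha> \<in> K\<close>] by blast
    qed
  qed
  then have "|K| <o \<kappa>"
    unfolding eventually_co_small by (rule card_of_subset_less[rotated]) (use K(1) BF in auto)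
  then show False using K(2) by blast
qed

end

theorem theorem4p10:
  fixes \<kappa> :: "'k rel"
    and f g :: "'k \<Rightarrow> 'k rel"
    and U :: "('a, 's) ualg"
    and Av :: "'a \<times> 'a \<Rightarrow> 'a"
  assumes "inaccessible \<kappa>"
    and "dagger \<kappa> f g"
    and "universal_algebra U"
    and "ctwo \<le>o |universe U|"
    and "|universe U| <o \<kappa>"
    and "average U Av"
  shows "\<exists>E\<^sub>1 \<in> ualg_hom (reduced_power U \<kappa>) (reduced_power U \<kappa>).
    (\<forall>X \<in> universe (reduced_power U \<kappa>). E\<^sub>1 (E\<^sub>1 X) = E\<^sub>1 X) \<and>
    ualg_isomorphic (hom_image E\<^sub>1 (reduced_power U \<kappa>) (reduced_power U \<kappa>)) (reduced_power U \<kappa>) \<and>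
    (\<forall>\<Delta> \<in> ualg_hom (ualg_power U (Field \<kappa>)) (ualg_power U (Field \<kappa>)).
       (\<forall>\<sigma> \<in> universe (ualg_power U (Field \<kappa>)). quot_map U \<kappa> (\<Delta> \<sigma>) = E\<^sub>1 (quot_map U \<kappa> \<sigma>)) \<longrightarrow>
       (\<forall>\<mu> :: 'k rel. Card_order \<mu> \<and> \<mu> <o \<kappa> \<longrightarrow>
          |{\<alpha> \<in> Field \<kappa>. \<not> (\<exists>Y. strong_support U (Field \<kappa>) ((\<lambda>\<sigma>. \<sigma> \<alpha>) \<circ> \<Delta>) Y \<and> |Y| \<le>o \<mu>)}| =o \<kappa>)) \<and>
    (changing U Av \<longrightarrow>
       (\<exists>\<sigma> \<in> universe (ualg_power U (Field \<kappa>)).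
          \<forall>\<tau> \<in> universe (ualg_power U (Field \<kappa>)).
            E\<^sub>1 (quot_map U \<kappa> \<sigma>) = quot_map U \<kappa> \<tau> \<longrightarrow>
            |{\<alpha> \<in> Field \<kappa>. \<sigma> \<alpha> = \<tau> \<alpha>}| <o \<kappa>))"
proof -
  have "Cinfinite \<kappa>"
    using assms(1) cinfinite_mono[OF ordLess_imp_ordLeq, of natLeq \<kappa>]
    by (simp add: inaccessible_def natLeq_cinfinite)
  moreover have "regularCard \<kappa>" using assms(1) by (simp add: inaccessible_def)
  ultimately interpret dagger_cardinal \<kappa> f g
    by unfold_locales (use assms(2) in auto)
  have "|UNIV :: bool set| \<le>o |universe U|" using assms(4) by (simp add: ctwo_def)
  then obtain e :: "bool \<Rightarrow> 'a" where e: "inj e" "range e \<subseteq> universe U"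
    unfolding card_of_ordLeq[symmetric] by blast
  have ne: "universe U \<noteq> {}" using e(2) by blast
  obtain r :: "('k \<Rightarrow> ('k \<Rightarrow> bool) set) rel" and q A
    where "averaging_system \<kappa> U Av r q A"
  proof (rule coherent_involutions[OF assms(5) ne], goal_cases)
    case (1 r q A)
    have "averaging_system \<kappa> U Av r q A"
      by unfold_locales (fact assms(3) ne assms(6) 1)+
    then show ?thesis by (rule 1(1))
  qed
  then interpret averaging_system \<kappa> U Av r q A .
  have "e True \<noteq> e False" using e(1) by (simp add: inj_eq)
  moreover have eU: "e True \<in> universe U" "e False \<in> universe U" using e(2) by auto
  \<comment> \<open>The average of two distinct elements differs from at least one of them; by
    symmetry that one can be put first.\<close>
  ultimately obtain a b where ab: "a \<in> universe U" "b \<in> universe U" "Av (a, b) \<noteq> a"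
    using Av_commute[OF eU] by metis
  show ?thesis
    using proj_hom proj_proj proj_image_isomorphic proj_changing lift_without_small_support[OF ab]
    by (intro bexI[of _ proj] conjI) blast+
qed

end
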